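(* For any scaling function $\{a_n(t)\}_{n\in\mathbb{N},t>0}$ satisfying $\lim_{n\to\infty}\frac{\log a_n(t)}{n}=0$ for every $t>0$, there exists an ergodic Lebesgue measure preserving rigid transformation $T$ with $\underline{\mathrm{ent}}_{a_n(t)}^{\mu}(T)=\infty$.
   Context: Scaling function: a family $\{a_n(t)\}_{n\in\mathbb{N},t>0}$ of positive sequences increasing to infinity and monotone in $t$, i.e. $a_n(t)\le a_{n+1}(t)$, $\lim_{n\to\infty}a_n(t)=+\infty$ for every $t>0$, and $a_n(t_1)\le a_n(t_2)$ for $t_2>t_1>0$. "Lebesgue measure preserving transformation" means an invertible transformation $T$ of $X$ preserving normalized Lebesgue measure $\mu$; the constructions can be viewed as taking place on $X=\mathbb{T}^2=\mathbb{R}^2/\mathbb{Z}^2$, the disc $\mathbb{D}$, or the annulus $\mathbb{A}=\mathbb{S}^1\times[0,1]$. Rigid: there is an increasing sequence $\{t_n\}_{n\in\mathbb{N}}$ of positive integers such that $f\circ T^{t_n}\to f$ in $L^2$ for every $f\in L^2(X,\mu)$. Lower slow entropy. For a finite measurable partition $\mathcal{P}=\{P_1,\dots,P_m\}$, the $n$-name of $x$ is $w(x)=(w_k(x))_{k=0}^{n-1}\in\{1,\dots,m\}^n$ with $T^k(x)\in P_{w_k(x)}$. For words of length $n$, $d_n^H(w,w')=\frac1n\#\{0\le k\le n-1: w_k\ne w'_k\}$ (Hamming metric). Put $B_{\mathcal{P},n}(x,T,\epsilon)=\{y\in X: d_n^H(w(x),w(y))<\epsilon\}$ and let $S_{\mathcal{P}}(T,n,\epsilon)$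 be the minimal cardinality of a family of such balls whose union has $\mu$-measure greater than $1-\epsilon$. Let $B(\epsilon,\mathcal{P})=\{t>0:\liminf_{n\to\infty}\frac{S_{\mathcal{P}}(T,n,\epsilon)}{a_n(t)}>0\}$, $A(\epsilon,\mathcal{P})=\sup B(\epsilon,\mathcal{P})$ if this set is nonempty and $A(\epsilon,\mathcal{P})=0$ otherwise. Then $\underline{\mathrm{ent}}_{a_n(t)}^{\mu}(T)=\sup_{\mathcal{P}}\lim_{\epsilon\to0}A(\epsilon,\mathcal{P})$, the supremum being over finite measurable partitions. *)

theory Defs
  imports "HOL-Analysis.Analysis"
begin

subsection \<open>Scaling functions\<close>

definition scaling_function :: "(nat \<Rightarrow> real \<Rightarrow> real) \<Rightarrow> bool" where
  "scaling_function a \<longleftrightarrow>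
     (\<forall>n. \<forall>t>0. 0 < a n t) \<and>
     (\<forall>n. \<forall>t>0. a n t \<le> a (Suc n) t) \<and>
     (\<forall>t>0. filterlim (\<lambda>n. a n t) at_top sequentially) \<and>
     (\<forall>n t1 t2. 0 < t1 \<longrightarrow> t1 < t2 \<longrightarrow> a n t1 \<le> a n t2)"

subsection \<open>The phase spaces\<close>

text \<open>The circle \<open>\<real>/\<int>\<close> is represented by its fundamental domain \<open>{0..<1}\<close>; only the measure
  structure of the spaces is used.\<close>

definition torus :: "(real \<times> real) set" where
  "torus = {0..<1} \<times> {0..<1}"

definition disc :: "(real \<times> real) set" where
  "disc = cball 0 1"

definition annulus :: "(real \<times> real) set" where
  "annulus = {0..<1} \<times> {0..1}"

definition normalized_lebesgue :: "'a::euclidean_space set \<Rightarrow> 'a measure" where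
  "normalized_lebesgue X = uniform_measure (lebesgue_on X) X"

subsection \<open>Measure preserving transformations\<close>

definition invertible_measure_preserving :: "'a measure \<Rightarrow> ('a \<Rightarrow> 'a) \<Rightarrow> bool" where
  "invertible_measure_preserving M T \<longleftrightarrow>
     bij_betw T (space M) (space M) \<and>
     T \<in> measurable M M \<and>
     inv_into (space M) T \<in> measurable M M \<and>
     distr M M T = M"

definition ergodic :: "'a measure \<Rightarrow> ('a \<Rightarrow> 'a) \<Rightarrow> bool" where
  "ergodic M T \<longleftrightarrow>
     (\<forall>A\<in>sets M. T -` A \<inter> space M = A \<longrightarrow>
        emeasure M A = 0 \<or> emeasure M (space M - A) = 0)"

definition square_integrable :: "'a measure \<Rightarrow> ('a \<Rightarrow> complex) \<Rightarrow> bool" where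
  "square_integrable M f \<longleftrightarrow>
     f \<in> borel_measurable M \<and> integrable M (\<lambda>x. (norm (f x))\<^sup>2)"

definition L2_seminorm :: "'a measure \<Rightarrow> ('a \<Rightarrow> complex) \<Rightarrow> real" where
  "L2_seminorm M f = sqrt (\<integral>x. (norm (f x))\<^sup>2 \<partial>M)"

definition rigid :: "'a measure \<Rightarrow> ('a \<Rightarrow> 'a) \<Rightarrow> bool" where
  "rigid M T \<longleftrightarrow>
     (\<exists>t :: nat \<Rightarrow> nat. strict_mono t \<and> (\<forall>n. 0 < t n) \<and>
        (\<forall>f. square_integrable M f \<longrightarrow>
           (\<lambda>n. L2_seminorm M (\<lambda>x. f ((T ^^ t n) x) - f x)) \<longlonglongrightarrow> 0))"

subsection \<open>Lower slow entropy\<close>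

text \<open>A partition into \<open>m\<close> pieces is the family \<open>P 1, \<dots>, P m\<close>; values of \<open>P\<close> at other indices
  are irrelevant.\<close>

definition finite_measurable_partition :: "'a measure \<Rightarrow> nat \<Rightarrow> (nat \<Rightarrow> 'a set) \<Rightarrow> bool" where
  "finite_measurable_partition M m P \<longleftrightarrow>
     (\<forall>i\<in>{1..m}. P i \<in> sets M) \<and>
     disjoint_family_on P {1..m} \<and>
     (\<Union>i\<in>{1..m}. P i) = space M"

text \<open>The infinite name of \<open>x\<close>; the \<open>n\<close>-name is its restriction to \<open>k < n\<close>.\<close>

definition name :: "nat \<Rightarrow> (nat \<Rightarrow> 'a set) \<Rightarrow> ('a \<Rightarrow> 'a) \<Rightarrow> 'a \<Rightarrow> nat \<Rightarrow> nat" where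
  "name m P T x k = (THE i. i \<in> {1..m} \<and> (T ^^ k) x \<in> P i)"

definition hamming_dist :: "nat \<Rightarrow> (nat \<Rightarrow> nat) \<Rightarrow> (nat \<Rightarrow> nat) \<Rightarrow> real" where
  "hamming_dist n w w' = real (card {k. k < n \<and> w k \<noteq> w' k}) / real n"

definition hamming_ball ::
  "'a measure \<Rightarrow> nat \<Rightarrow> (nat \<Rightarrow> 'a set) \<Rightarrow> ('a \<Rightarrow> 'a) \<Rightarrow> nat \<Rightarrow> real \<Rightarrow> 'a \<Rightarrow> 'a set" where
  "hamming_ball M m P T n \<epsilon> x =
     {y \<in> space M. hamming_dist n (name m P T x) (name m P T y) < \<epsilon>}"

text \<open>For \<open>\<epsilon> > 0\<close> the \<open>LEAST\<close> is attained: there are only finitely many \<open>n\<close>-names, hence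
  finitely many balls, and together they cover the space.\<close>

definition min_ball_cover ::
  "'a measure \<Rightarrow> nat \<Rightarrow> (nat \<Rightarrow> 'a set) \<Rightarrow> ('a \<Rightarrow> 'a) \<Rightarrow> nat \<Rightarrow> real \<Rightarrow> nat" where
  "min_ball_cover M m P T n \<epsilon> =
     (LEAST k. \<exists>F. F \<subseteq> hamming_ball M m P T n \<epsilon> ` space M \<and> finite F \<and> card F = k \<and>
        measure M (\<Union>F) > 1 - \<epsilon>)"

definition slow_growth_set ::
  "(nat \<Rightarrow> real \<Rightarrow> real) \<Rightarrow> 'a measure \<Rightarrow> nat \<Rightarrow> (nat \<Rightarrow> 'a set) \<Rightarrow> ('a \<Rightarrow> 'a) \<Rightarrow> real \<Rightarrow> real set"
  where
  "slow_growth_set a M m P T \<epsilon> =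
     {t. 0 < t \<and> liminf (\<lambda>n. ereal (real (min_ball_cover M m P T n \<epsilon>) / a n t)) > 0}"

definition slow_growth_rate ::
  "(nat \<Rightarrow> real \<Rightarrow> real) \<Rightarrow> 'a measure \<Rightarrow> nat \<Rightarrow> (nat \<Rightarrow> 'a set) \<Rightarrow> ('a \<Rightarrow> 'a) \<Rightarrow> real \<Rightarrow> ereal"
  where
  "slow_growth_rate a M m P T \<epsilon> =
     (if slow_growth_set a M m P T \<epsilon> = {} then 0
      else (SUP t\<in>slow_growth_set a M m P T \<epsilon>. ereal t))"

text \<open>On a probability space the rate is antitone in \<open>\<epsilon> > 0\<close>, so the one-sided limit below
  always exists in the extended reals.\<close>

definition lower_slow_entropy ::
  "(nat \<Rightarrow> real \<Rightarrow> real) \<Rightarrow> 'a measure \<Rightarrow> ('a \<Rightarrow> 'a) \<Rightarrow> ereal" where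
  "lower_slow_entropy a M T =
     (SUP (m, P) \<in> {(m, P). finite_measurable_partition M m P}.
        Lim (at_right 0) (\<lambda>\<epsilon>. slow_growth_rate a M m P T \<epsilon>))"

end

theory Submission
  imports Defs "HOL-Probability.Probability"
begin

text \<open>The transformation is a random scenery over the binary odometer \<open>R\<close>: on pairs \<open>(x, w)\<close> of bit
  sequences with the fair coin measure, \<open>(x, w)\<close> is sent to \<open>R x\<close> together with \<open>w\<close> translated by the
  set of bits outside a sparse set \<open>E\<close> that the carry changes. After \<open>k\<close> steps the scenery is
  translated by the difference of \<open>x\<close> and \<open>R^k x\<close> outside \<open>E\<close>.

  The set \<open>E\<close> contains longer and longer blocks \<open>{e n..<e n + n}\<close>. Adding \<open>2^(e n)\<close> changes only bits in
  the block unless they are all ones, so \<open>2^(e n)\<close> is a rigidity sequence. On the other hand an orbit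
  piece of length \<open>2^m\<close> visits each site at most \<open>2^c\<close> times, \<open>c\<close> being the number of elements of \<open>E\<close>
  below \<open>m\<close>. As the scenery is random, a Chernoff bound shows that Hamming balls of length \<open>N\<close> have
  measure at most \<open>exp (- N / (8 * 2^c))\<close>; since \<open>c\<close> may grow as slowly as one likes, this beats any
  subexponential scale. The same occupation bound makes most pairs of times use disjoint sites, hence
  independent sceneries, which gives ergodicity. Finally, the model is carried over to \<open>X\<close> by an
  isomorphism modulo null sets.\<close>

section \<open>Fair coin tosses\<close>

text \<open>The two requirements pull against each other. If \<open>E\<close> were empty, the sites
  met by an orbit without overflow would all be distinct, the bits read at the origin would be
  independent coin tosses, and rigidity would be impossible. Each element of \<open>E\<close> below
  \<open>m\<close> doubles the bound on the visits to a site during \<open>2 ^ m\<close> steps. A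
  block of length \<open>n\<close> thus buys a failure probability \<open>(1 / 2) ^ n\<close> at
  time \<open>2 ^ e n\<close> and costs a factor \<open>2 ^ n\<close> in the exponent of the ball
  bound. This cost depends on the length of the block and not on its position, so each block can be
  postponed until the scale lies below the weakened bound; subexponential growth guarantees that
  this happens. Ergodicity asks for infinitely many bits outside \<open>E\<close>, to make
  \<open>2 ^ c\<close> small against \<open>2 ^ m\<close>. A separate obstacle is that the model
  lives on a Borel space and modulo null sets, while the transformation sought is a bijection of all
  of \<open>X\<close> that respects Lebesgue measurable sets.\<close>

lemma distr_funpow:
  assumes S [measurable]: "S \<in> measurable N N" and d: "distr N N S = N"
  shows "distr N N (S ^^ k) = N"
proof (induction k)
  case (Suc k)
  have [measurable]: "S ^^ k \<in> measurable N N" by (rule measurable_compose_n[OF S])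
  have "distr N N (S ^^ Suc k) = distr (distr N N (S ^^ k)) N S"
    by (subst distr_distr) auto
  then show ?case unfolding Suc d .
qed (simp add: distr_id id_def)

definition coin :: "(nat \<Rightarrow> bool) measure" where
  "coin = PiM UNIV (\<lambda>_. measure_pmf (bernoulli_pmf (1/2)))"

interpretation coords: product_prob_space "\<lambda>_::nat. measure_pmf (bernoulli_pmf (1/2))" UNIV
  by unfold_locales

interpretation coin: prob_space coin
  unfolding coin_def by (rule coords.prob_space_axioms)

lemma space_coin [simp]: "space coin = UNIV"
  by (simp add: coin_def space_PiM)

lemma measure_coin_UNIV [simp]: "measure coin UNIV = 1"
  using coin.prob_space by simp

lemma sets_coin: "sets coin = sets (PiM UNIV (\<lambda>_. count_space UNIV))"
  unfolding coin_def by (intro sets_PiM_cong) auto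

lemma measurable_coin_component [measurable]: "(\<lambda>x. x i) \<in> measurable coin (count_space UNIV)"
proof -
  have "(\<lambda>x. x i) \<in> measurable (PiM UNIV (\<lambda>_::nat. count_space (UNIV::bool set))) (count_space UNIV)"
    by measurable
  then show ?thesis
    using measurable_cong_sets[OF sets_coin refl] by blast
qed

lemma measurable_into_coin:
  assumes "\<And>i. (\<lambda>x. f x i) \<in> measurable M (count_space UNIV)"
  shows "f \<in> measurable M coin"
proof -
  have "f \<in> measurable M (PiM UNIV (\<lambda>_. count_space UNIV))"
    by (rule measurable_PiM_single') (use assms in auto)
  then show ?thesis
    using measurable_cong_sets[OF refl sets_coin] by blast
qed

definition cyl :: "nat \<Rightarrow> (nat \<Rightarrow> bool) \<Rightarrow> (nat \<Rightarrow> bool) set" where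
  "cyl m c = {x. \<forall>i<m. x i = c i}"

text \<open>Restriction to \<open>I\<close> has values in a finite discrete space, so every function
  that factors through it is measurable.\<close>

lemma measurable_coin_finite:
  assumes "finite I" "\<And>x y. (\<And>i. i \<in> I \<Longrightarrow> x i = y i) \<Longrightarrow> f x = f y"
  shows "f \<in> measurable coin (count_space UNIV)"
proof -
  have r: "(\<lambda>x. restrict x I) \<in> measurable coin (PiM I (\<lambda>_. count_space UNIV))"
    by (rule measurable_restrict) simp
  have "PiM I (\<lambda>_. count_space (UNIV::bool set)) = count_space (PiE I (\<lambda>_. UNIV))"
    by (rule count_space_PiM_finite[OF assms(1)]) auto
  then have f: "f \<in> measurable (PiM I (\<lambda>_. count_space UNIV)) (count_space UNIV)"
    by simp
  have "(\<lambda>x. f (restrict x I)) \<in> measurable coin (count_space UNIV)"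
    using measurable_compose[OF r f] .
  moreover have "f (restrict x I) = f x" for x
    by (rule assms(2)) auto
  ultimately show ?thesis by simp
qed

lemma sets_coin_finite:
  assumes "finite I" "\<And>x y. (\<And>i. i \<in> I \<Longrightarrow> x i = y i) \<Longrightarrow> x \<in> A \<longleftrightarrow> y \<in> A"
  shows "A \<in> sets coin"
proof -
  have "(\<lambda>x. x \<in> A) \<in> measurable coin (count_space UNIV)"
    by (rule measurable_coin_finite[OF assms(1)], rule assms(2))
  then have "{x \<in> space coin. x \<in> A} \<in> sets coin"
    by (simp add: pred_def)
  then show ?thesis by simp
qed

lemma cyl_sets [measurable]: "cyl m c \<in> sets coin"
  by (rule sets_coin_finite[of "{..<m}"]) (auto simp: cyl_def)

lemma prob_coordinates:
  assumes "finite I"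
  shows "measure coin {x. \<forall>i\<in>I. x i = c i} = (1/2) ^ card I"
proof -
  have e: "{x. \<forall>i\<in>I. x i = c i} = prod_emb UNIV (\<lambda>_. measure_pmf (bernoulli_pmf (1/2))) I (PiE I (\<lambda>i. {c i}))"
    by (intro set_eqI) (simp add: prod_emb_iff PiE_iff Ball_def)
  have "measure coin {x. \<forall>i\<in>I. x i = c i} = (\<Prod>i\<in>I. measure (measure_pmf (bernoulli_pmf (1/2))) {c i})"
    unfolding e coin_def by (rule coords.measure_PiM_emb) (use assms in auto)
  also have "\<dots> = (\<Prod>i\<in>I. 1/2)"
    by (intro prod.cong refl, case_tac "c x") (auto simp: measure_pmf_single)
  finally show ?thesis by simp
qed

lemma prob_cyl: "measure coin (cyl m c) = (1/2)^m"
  using prob_coordinates[of "{..<m}" c] by (simp add: cyl_def Ball_def)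

lemma coin_singleton: "{x} \<in> null_sets coin"
proof -
  have e: "{x} = (\<Inter>m. cyl m x)"
    by (auto simp: cyl_def)
  have s: "{x} \<in> sets coin" unfolding e by (intro sets.countable_INT image_subsetI cyl_sets) auto
  have "measure coin {x} \<le> (1/2)^m" for m
    unfolding prob_cyl[of m x, symmetric] by (rule coin.finite_measure_mono[OF _ cyl_sets]) (simp add: cyl_def)
  moreover have "(\<lambda>m. (1/2::real)^m) \<longlonglongrightarrow> 0" by (rule LIMSEQ_realpow_zero) auto
  ultimately have "measure coin {x} \<le> 0"
    by (intro LIMSEQ_le_const) auto
  then show ?thesis
    using s by (auto simp: null_sets_def coin.emeasure_eq_measure measure_le_0_iff)
qed

lemma coin_eqI:
  assumes "prob_space N" "sets N = sets coin" "\<And>m c. measure N (cyl m c) = (1/2)^m"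
  shows "N = coin"
proof -
  interpret N: prob_space N by fact
  let ?E = "insert {} (range (case_prod cyl))"
  have sg: "sets coin = sigma_sets UNIV ?E"
  proof
    have "{x. x i \<in> A} \<in> sigma_sets UNIV ?E" for i and A :: "bool set"
    proof -
      \<comment> \<open>Prescriptions are made \<open>False\<close> beyond \<open>i\<close>: this
        leaves finitely many, and each sequence of the event still agrees up to \<open>i\<close>
        with one of them.\<close>
      let ?C = "{c::nat \<Rightarrow> bool. c i \<in> A \<and> (\<forall>j>i. \<not> c j)}"
      have fc: "finite ?C"
      proof (rule finite_subset)
        show "?C \<subseteq> (\<lambda>X j. j \<in> X) ` Pow {..i}"
        proof
          fix c assume "c \<in> ?C"
          then show "c \<in> (\<lambda>X j. j \<in> X) ` Pow {..i}"
            by (intro image_eqI[of _ _ "{j. c j}"]) (auto simp: not_less[symmetric])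
        qed
      qed auto
      have "{x. x i \<in> A} = (\<Union>c\<in>?C. cyl (Suc i) c)"
      proof (intro equalityI subsetI)
        fix x assume "x \<in> {x. x i \<in> A}"
        then show "x \<in> (\<Union>c\<in>?C. cyl (Suc i) c)"
          by (intro UN_I[of "\<lambda>j. j \<le> i \<and> x j"]) (auto simp: cyl_def)
      qed (auto simp: cyl_def)
      moreover have "(\<Union>c\<in>?C. cyl (Suc i) c) \<in> sigma_sets UNIV ?E"
        by (rule sigma_sets_UNION) (auto intro!: sigma_sets.Basic countable_finite fc)
      ultimately show ?thesis by simp
    qed
    moreover have "(UNIV \<rightarrow>\<^sub>E space (count_space (UNIV :: bool set))) = (UNIV :: (nat \<Rightarrow> bool) set)"
      by (auto simp: PiE_def)
    ultimately show "sets coin \<subseteq> sigma_sets UNIV ?E"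
      unfolding sets_coin sets_PiM_single by (simp only:) (intro sigma_sets_mono, auto)
    show "sigma_sets UNIV ?E \<subseteq> sets coin"
      using sets.sigma_sets_subset[of ?E coin] by fastforce
  qed
  show ?thesis
  proof (rule measure_eqI_generator_eq[where E="?E" and \<Omega>=UNIV and A="\<lambda>_. UNIV"])
    show "Int_stable ?E"
    proof (rule Int_stableI)
      fix a b assume "a \<in> ?E" "b \<in> ?E"
      moreover have "cyl m c \<inter> cyl n d \<in> ?E" for m c n d
      proof (cases "\<exists>x. x \<in> cyl m c \<inter> cyl n d")
        case True
        then obtain x where "x \<in> cyl m c \<inter> cyl n d" by blast
        \<comment> \<open>Any common point can serve as the prescription of the longer
          cylinder.\<close>
        then have "cyl m c \<inter> cyl n d = cyl (max m n) x"
          unfolding cyl_def by (intro set_eqI) (simp add: less_max_iff_disj, blast)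
        then show ?thesis by auto
      qed auto
      moreover have "c = {} \<or> (\<exists>m d. c = cyl m d)" if "c \<in> ?E" for c
        using that by auto
      ultimately show "a \<inter> b \<in> ?E" by (metis Int_empty_left Int_empty_right insertI1)
    qed
    show "sets N = sigma_sets UNIV ?E" "sets coin = sigma_sets UNIV ?E" using sg assms(2) by auto
    show "emeasure N X = emeasure coin X" if "X \<in> ?E" for X
      using that by (auto simp: N.emeasure_eq_measure coin.emeasure_eq_measure assms(3) prob_cyl)
    have "UNIV = cyl 0 undefined" by (auto simp: cyl_def)
    then show "range (\<lambda>_. UNIV) \<subseteq> ?E" by auto
  qed (auto simp: N.emeasure_eq_measure)
qed

section \<open>The odometer and its shift cocycle\<close>

unbundle bit_operations_syntax

text \<open>A bit sequence is read as a \<open>2\<close>-adic integer, least significant bit first; \<open>odometer e\<close> adds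
  \<open>2^e\<close> to it.\<close>

definition odometer :: "nat \<Rightarrow> (nat \<Rightarrow> bool) \<Rightarrow> nat \<Rightarrow> bool" where
  "odometer e x i \<longleftrightarrow> x i \<noteq> (e \<le> i \<and> (\<forall>j. e \<le> j \<and> j < i \<longrightarrow> x j))"

definition odometer_inv :: "(nat \<Rightarrow> bool) \<Rightarrow> nat \<Rightarrow> bool" where
  "odometer_inv x i \<longleftrightarrow> x i \<noteq> (\<forall>j<i. \<not> x j)"

text \<open>For 2-adic integers this is \<open>2 ^ e + 2 ^ e = 2 ^ Suc e\<close>. If bit
  \<open>e\<close> is set, the first addition clears it and carries on, and the second stops at
  \<open>e\<close>; if it is clear, the first only sets it and the second carries on.\<close>

lemma odometer_twice: "odometer e (odometer e x) = odometer (Suc e) x"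
proof
  fix i
  consider "i < e" | "i = e" | "e < i" by linarith
  then show "odometer e (odometer e x) i = odometer (Suc e) x i"
  proof cases
    case 3
    have e: "odometer e x e \<longleftrightarrow> \<not> x e"
      by (auto simp: odometer_def)
    show ?thesis
    proof (cases "x e")
      case True
      then have "\<not> (\<forall>j. e \<le> j \<and> j < i \<longrightarrow> odometer e x j)"
        using e 3 by auto
      moreover have "(\<forall>j. e \<le> j \<and> j < i \<longrightarrow> x j) \<longleftrightarrow> (\<forall>j. Suc e \<le> j \<and> j < i \<longrightarrow> x j)"
        using True by (metis Suc_leI le_eq_less_or_eq Suc_leD)
      ultimately show ?thesis
        using 3 unfolding odometer_def[of e "odometer e x"] odometer_def[of "Suc e"]
        by (simp add: odometer_def[of e x i] Suc_le_eq)
    next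
      case False
      have later: "odometer e x j = x j" if "e < j" for j
        using that False by (auto simp: odometer_def)
      have "(\<forall>j. e \<le> j \<and> j < i \<longrightarrow> odometer e x j) \<longleftrightarrow> (\<forall>j. Suc e \<le> j \<and> j < i \<longrightarrow> x j)"
        using e False later by (metis Suc_le_eq le_eq_less_or_eq)
      then show ?thesis
        using 3 later unfolding odometer_def[of e "odometer e x"] odometer_def[of "Suc e"]
        by (simp add: Suc_le_eq)
    qed
  qed (auto simp: odometer_def)
qed

lemma odometer_funpow: "(odometer 0 ^^ (2 ^ e)) = odometer e"
proof (induction e)
  case (Suc e)
  have "(odometer 0 ^^ (2 ^ Suc e)) = odometer e \<circ> odometer e"
    by (simp add: mult_2 funpow_add Suc)
  then show ?case by (auto simp: odometer_twice)
qed simp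

text \<open>A carry leaves zeros behind it, so the resulting digits reveal how far it went. This is
  what lets a borrow undo it.\<close>

lemma odometer_carry: "(\<forall>j<i. \<not> odometer 0 x j) \<longleftrightarrow> (\<forall>j<i. x j)"
proof
  assume *: "\<forall>j<i. \<not> odometer 0 x j"
  have "j < i \<longrightarrow> x j" for j
  proof (induction j rule: less_induct)
    case (less j)
    show ?case
    proof
      assume "j < i"
      then have "\<forall>k<j. x k" using less by simp
      then have "odometer 0 x j = (\<not> x j)" by (simp add: odometer_def)
      then show "x j" using * \<open>j < i\<close> by blast
    qed
  qed
  then show "\<forall>j<i. x j" by simp
qed (auto simp: odometer_def)

lemma odometer_inv_carry: "(\<forall>j<i. odometer_inv x j) \<longleftrightarrow> (\<forall>j<i. \<not> x j)"
proof
  assume *: "\<forall>j<i. odometer_inv x j"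
  have "j < i \<longrightarrow> \<not> x j" for j
  proof (induction j rule: less_induct)
    case (less j)
    show ?case
    proof
      assume "j < i"
      then have "\<forall>k<j. \<not> x k" using less by simp
      then have "odometer_inv x j = (\<not> x j)" by (simp add: odometer_inv_def)
      then show "\<not> x j" using * \<open>j < i\<close> by blast
    qed
  qed
  then show "\<forall>j<i. \<not> x j" by simp
qed (auto simp: odometer_inv_def)

lemma odometer_inv_odometer [simp]: "odometer_inv (odometer 0 x) = x"
proof
  fix i
  have "odometer_inv (odometer 0 x) i \<longleftrightarrow> odometer 0 x i \<noteq> (\<forall>j<i. x j)"
    unfolding odometer_inv_def odometer_carry ..
  then show "odometer_inv (odometer 0 x) i = x i"
    by (simp add: odometer_def) blast
qed

lemma odometer_odometer_inv [simp]: "odometer 0 (odometer_inv x) = x"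
proof
  fix i
  have "odometer 0 (odometer_inv x) i \<longleftrightarrow> odometer_inv x i \<noteq> (\<forall>j<i. odometer_inv x j)"
    by (simp add: odometer_def)
  then show "odometer 0 (odometer_inv x) i = x i"
    unfolding odometer_inv_carry by (simp add: odometer_inv_def) blast
qed

lemma odometer_prefix: "(\<And>j. j \<le> i \<Longrightarrow> x j = y j) \<Longrightarrow> odometer e x i = odometer e y i"
  unfolding odometer_def by (metis le_eq_less_or_eq)

lemma odometer_inv_prefix: "(\<And>j. j \<le> i \<Longrightarrow> x j = y j) \<Longrightarrow> odometer_inv x i = odometer_inv y i"
  unfolding odometer_inv_def by (metis le_eq_less_or_eq)

lemma measurable_odometer [measurable]: "odometer e \<in> measurable coin coin"
  by (rule measurable_into_coin, rule measurable_coin_finite[of "{..i}" for i])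
    (auto intro!: odometer_prefix)

lemma measurable_odometer_inv [measurable]: "odometer_inv \<in> measurable coin coin"
  by (rule measurable_into_coin, rule measurable_coin_finite[of "{..i}" for i])
    (auto intro!: odometer_inv_prefix)

lemma vimage_odometer_cyl: "odometer 0 -` cyl m c = cyl m (odometer_inv c)"
proof (intro equalityI subsetI)
  fix x assume "x \<in> odometer 0 -` cyl m c"
  then have "odometer_inv (odometer 0 x) i = odometer_inv c i" if "i < m" for i
    using that by (intro odometer_inv_prefix) (auto simp: cyl_def)
  then show "x \<in> cyl m (odometer_inv c)" by (simp add: cyl_def)
next
  fix x assume "x \<in> cyl m (odometer_inv c)"
  then have "odometer 0 x i = odometer 0 (odometer_inv c) i" if "i < m" for i
    using that by (intro odometer_prefix) (auto simp: cyl_def)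
  then show "x \<in> odometer 0 -` cyl m c" by (simp add: cyl_def)
qed

lemma distr_odometer: "distr coin coin (odometer 0) = coin"
proof (rule coin_eqI)
  show "prob_space (distr coin coin (odometer 0))"
    by (rule coin.prob_space_distr) simp
  show "measure (distr coin coin (odometer 0)) (cyl m c) = (1 / 2) ^ m" for m c
    by (subst measure_distr) (auto simp: vimage_odometer_cyl prob_cyl)
qed simp

lemma distr_odometer_funpow: "distr coin coin (odometer 0 ^^ k) = coin"
  by (rule distr_funpow[OF measurable_odometer distr_odometer])

section \<open>Residues modulo powers of two\<close>

text \<open>The residue modulo \<open>2 ^ m\<close> of the 2-adic integer \<open>x\<close>. It also
  serves as a code of the first \<open>m\<close> bits, which \<open>bit\<close> decodes.\<close>

definition val :: "nat \<Rightarrow> (nat \<Rightarrow> bool) \<Rightarrow> nat" where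
  "val m x = horner_sum of_bool 2 (map x [0..<m])"

lemma bit_val: "bit (val m x) i \<longleftrightarrow> i < m \<and> x i"
  by (auto simp: val_def bit_horner_sum_bit_iff)

lemma val_Suc: "val (Suc m) x = val m x + 2 ^ m * of_bool (x m)"
  by (simp add: val_def horner_sum_append)

lemma val_less: "val m x < 2 ^ m"
  by (induction m) (auto simp: val_Suc, simp add: val_def)

lemma val_eq_iff: "val m x = val m y \<longleftrightarrow> (\<forall>i<m. x i = y i)"
  by (auto simp: bit_eq_iff bit_val)

lemma val_ones: "Suc (val m x) = 2 ^ m \<longleftrightarrow> (\<forall>i<m. x i)"
proof (induction m)
  case (Suc m)
  show ?case
    using Suc val_less[of m x] by (auto simp: val_Suc less_Suc_eq)
qed (simp add: val_def)

lemma val_odometer: "val m (odometer 0 x) = Suc (val m x) mod 2 ^ m"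
proof (induction m)
  case (Suc m)
  show ?case
  proof (cases "\<forall>i<m. x i")
    case True
    then have "Suc (val m x) = 2 ^ m" by (simp add: val_ones)
    moreover from this have "val m (odometer 0 x) = 0" using Suc by simp
    moreover have "odometer 0 x m = (\<not> x m)" using True by (simp add: odometer_def)
    moreover from \<open>Suc (val m x) = 2 ^ m\<close>
    have "Suc (val (Suc m) x) = (if x m then 2 * 2 ^ m else 2 ^ m)"
      by (simp add: val_Suc)
    then have "Suc (val (Suc m) x) mod 2 ^ Suc m = (if x m then 0 else 2 ^ m)" by simp
    ultimately show ?thesis by (simp add: val_Suc[of m "odometer 0 x"])
  next
    case False
    then have "Suc (val m x) < 2 ^ m"
      using val_ones[of m x] val_less[of m x] by (metis Suc_lessI)
    moreover have "odometer 0 x m = x m" using False by (auto simp: odometer_def)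
    ultimately show ?thesis using Suc by (auto simp: val_Suc)
  qed
qed (simp add: val_def)

lemma val_odometer_funpow: "val m ((odometer 0 ^^ k) x) = (val m x + k) mod 2 ^ m"
proof (induction k)
  case (Suc k)
  then show ?case by (simp add: val_odometer mod_Suc_eq)
qed (simp add: val_less)

text \<open>On residues the odometer is translation by one in a cyclic group. Hence sums over
  \<open>2 ^ m\<close> steps of a function of the first \<open>m\<close> bits do not depend on
  \<open>x\<close>.\<close>

lemma bij_betw_val_odometer:
  "bij_betw (\<lambda>k. val m ((odometer 0 ^^ k) x)) {..<2 ^ m} {..<2 ^ m}"
proof -
  have "inj_on (\<lambda>k. val m ((odometer 0 ^^ k) x)) {..<2 ^ m}"
  proof (rule linorder_inj_onI')
    fix k l :: nat assume kl: "k \<in> {..<2 ^ m}" "l \<in> {..<2 ^ m}" "k < l"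
    show "val m ((odometer 0 ^^ k) x) \<noteq> val m ((odometer 0 ^^ l) x)"
    proof
      assume "val m ((odometer 0 ^^ k) x) = val m ((odometer 0 ^^ l) x)"
      then have "2 ^ m dvd (val m x + l) - (val m x + k)"
        using kl by (subst mod_eq_dvd_iff_nat[symmetric]) (simp_all add: val_odometer_funpow)
      then show False using kl by (auto dest: dvd_imp_le)
    qed
  qed
  moreover have "(\<lambda>k. val m ((odometer 0 ^^ k) x)) ` {..<2 ^ m} \<subseteq> {..<2 ^ m}"
    by (auto simp: val_less)
  ultimately show ?thesis
    by (simp add: bij_betw_def endo_inj_surj)
qed

text \<open>The bits outside \<open>E\<close> changed by one step of the odometer. The sequence of ones, whose carry does
  not stop, gets the arbitrary value \<open>0\<close>.\<close>

definition shift_step :: "nat set \<Rightarrow> (nat \<Rightarrow> bool) \<Rightarrow> nat" where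
  "shift_step E x = (if \<exists>i. \<not> x i then val (Suc (LEAST i. \<not> x i)) (\<lambda>i. i \<notin> E) else 0)"

text \<open>The first zero \<open>p\<close> absorbs the carry, so exactly the bits up to
  \<open>p\<close> change.\<close>

lemma bit_shift_step:
  assumes "\<exists>i. \<not> x i"
  shows "bit (shift_step E x) i \<longleftrightarrow> i \<notin> E \<and> odometer 0 x i \<noteq> x i"
proof -
  define p where "p = (LEAST i. \<not> x i)"
  have "\<not> x p" "\<forall>j<p. x j"
    using LeastI_ex[OF assms] not_less_Least by (auto simp: p_def)
  then have "i \<le> p \<longleftrightarrow> (\<forall>j<i. x j)"
    by (meson leI le_less_trans less_le_trans)
  moreover have "odometer 0 x i \<noteq> x i \<longleftrightarrow> (\<forall>j<i. x j)" by (auto simp: odometer_def)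
  ultimately show ?thesis
    using assms by (auto simp: shift_step_def bit_val p_def[symmetric])
qed

primrec site_shift :: "nat set \<Rightarrow> nat \<Rightarrow> (nat \<Rightarrow> bool) \<Rightarrow> nat" where
  "site_shift E 0 x = 0"
| "site_shift E (Suc k) x = site_shift E k x XOR shift_step E ((odometer 0 ^^ k) x)"

definition no_overflow :: "(nat \<Rightarrow> bool) \<Rightarrow> bool" where
  "no_overflow x \<longleftrightarrow> (\<forall>k. (odometer 0 ^^ k) x \<noteq> (\<lambda>_. True))"

text \<open>XOR telescopes along the orbit: a bit flipped an even number of times contributes
  nothing. Without overflow every single step changes a finite set of bits, as
  \<open>bit_shift_step\<close> requires.\<close>

lemma bit_shift:
  assumes "no_overflow x"
  shows "bit (site_shift E k x) i \<longleftrightarrow> i \<notin> E \<and> (odometer 0 ^^ k) x i \<noteq> x i"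
proof (induction k)
  case (Suc k)
  have "\<exists>i. \<not> (odometer 0 ^^ k) x i"
    using assms by (auto simp: no_overflow_def)
  then show ?case
    using Suc by (auto simp: bit_xor_iff bit_shift_step)
qed simp

text \<open>The shift determines the bits of \<open>odometer^k x\<close> outside \<open>E\<close>, so only the bits in \<open>E\<close> are free.\<close>

lemma shift_occupation:
  assumes "no_overflow x"
  shows "card {k. k < 2 ^ m \<and> site_shift E k x = v} \<le> 2 ^ card (E \<inter> {..<m})"
proof -
  let ?K = "{k. k < 2 ^ m \<and> site_shift E k x = v}"
  let ?g = "\<lambda>k. {i \<in> E \<inter> {..<m}. (odometer 0 ^^ k) x i}"
  have "inj_on ?g ?K"
  proof (rule inj_onI)
    fix k l assume k: "k \<in> ?K" and l: "l \<in> ?K" and eq: "?g k = ?g l"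
    have "(odometer 0 ^^ k) x i = (odometer 0 ^^ l) x i" if "i < m" for i
    proof (cases "i \<in> E")
      case True
      then show ?thesis using eq that by auto
    next
      case False
      have "bit (site_shift E k x) i = bit (site_shift E l x) i" using k l by simp
      then show ?thesis using False assms by (auto simp: bit_shift)
    qed
    then have "val m ((odometer 0 ^^ k) x) = val m ((odometer 0 ^^ l) x)"
      by (simp add: val_eq_iff)
    then show "k = l"
      using k l bij_betw_imp_inj_on[OF bij_betw_val_odometer, of m x] by (auto dest: inj_onD)
  qed
  then have "card ?K \<le> card (Pow (E \<inter> {..<m}))"
    by (rule card_inj_on_le) auto
  then show ?thesis by (subst (asm) card_Pow) simp_all
qed

lemma AE_no_overflow: "AE x in coin. no_overflow x"
proof -
  have "AE x in coin. (odometer 0 ^^ k) x \<noteq> (\<lambda>_. True)" for k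
  proof -
    have [measurable]: "odometer 0 ^^ k \<in> measurable coin coin" by (rule measurable_compose_n) simp
    have "AE y in distr coin coin (odometer 0 ^^ k). y \<noteq> (\<lambda>_. True)"
      unfolding distr_odometer_funpow by (rule AE_I'[OF coin_singleton]) auto
    then show ?thesis
      by (rule AE_distrD[rotated]) simp
  qed
  then show ?thesis unfolding no_overflow_def by (simp add: AE_all_countable)
qed

lemma measurable_shift_step [measurable]: "shift_step E \<in> measurable coin (count_space UNIV)"
  unfolding shift_step_def by measurable

lemma shift_block:
  assumes "no_overflow x" "{e..<e + n} \<subseteq> E" "j \<in> {e..<e + n}" "\<not> x j"
  shows "site_shift E (2 ^ e) x = 0"
proof (rule bit_eqI)
  fix i
  have "odometer e x i = x i" if "i \<notin> E"
  proof -
    have "i < e \<or> e + n \<le> i" using that assms(2) by (meson atLeastLessThan_iff in_mono leI)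
    then show ?thesis using assms(3,4) by (auto simp: odometer_def)
  qed
  then show "bit (site_shift E (2 ^ e) x) i = bit 0 i"
    by (auto simp: bit_shift[OF assms(1)] odometer_funpow)
qed

section \<open>Random scenery over the odometer\<close>

lemma indep_coordinates: "coin.indep_vars (\<lambda>_. count_space UNIV) (\<lambda>i x. x i) UNIV"
proof -
  let ?B = "measure_pmf (bernoulli_pmf (1/2))"
  have m: "(\<lambda>x. x i) \<in> measurable coin ?B" for i
    using measurable_coin_component by simp
  have "distr coin (PiM UNIV (\<lambda>_. ?B)) (\<lambda>x. \<lambda>i\<in>UNIV. x i) = PiM UNIV (\<lambda>i. distr coin ?B (\<lambda>x. x i))"
    using coords.PiM_component by (simp add: coin_def[symmetric] restrict_UNIV)
  then have "coin.indep_vars (\<lambda>_. ?B) (\<lambda>i x. x i) UNIV"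
    by (subst coin.indep_vars_iff_distr_eq_PiM) (use m in auto)
  then have "coin.indep_vars (\<lambda>_. count_space UNIV) (\<lambda>i. (\<lambda>b. b) \<circ> (\<lambda>x. x i)) UNIV"
    by (rule coin.indep_vars_compose) simp
  then show ?thesis by (simp add: comp_def)
qed

lemma prob_Int_disjoint_coordinates:
  assumes "finite I" "finite K" "I \<inter> K = {}"
    and A: "\<And>x y. (\<And>i. i \<in> I \<Longrightarrow> x i = y i) \<Longrightarrow> x \<in> A \<longleftrightarrow> y \<in> A"
    and B: "\<And>x y. (\<And>i. i \<in> K \<Longrightarrow> x i = y i) \<Longrightarrow> x \<in> B \<longleftrightarrow> y \<in> B"
  shows "measure coin (A \<inter> B) = measure coin A * measure coin B"
proof -
  have sets: "(\<lambda>x. restrict x S) ` C \<in> sets (PiM S (\<lambda>_. count_space UNIV))" if "finite S"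
    for S and C :: "(nat \<Rightarrow> bool) set"
  proof -
    have "PiM S (\<lambda>_. count_space (UNIV::bool set)) = count_space (PiE S (\<lambda>_. UNIV))"
      by (rule count_space_PiM_finite[OF that]) auto
    then show ?thesis by auto
  qed
  have e: "x \<in> C \<longleftrightarrow> restrict x S \<in> (\<lambda>x. restrict x S) ` C"
    if "\<And>x y. (\<And>i. i \<in> S \<Longrightarrow> x i = y i) \<Longrightarrow> x \<in> C \<longleftrightarrow> y \<in> C" for S C and x :: "nat \<Rightarrow> bool"
  proof
    assume "restrict x S \<in> (\<lambda>x. restrict x S) ` C"
    then obtain y where "y \<in> C" "restrict x S = restrict y S" by blast
    then show "x \<in> C" using that[of x y] by (metis restrict_apply')
  qed auto
  let ?A = "(\<lambda>x. restrict x I) ` A" and ?B = "(\<lambda>x. restrict x K) ` B"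
  have "coin.indep_var (PiM I (\<lambda>_. count_space UNIV)) (\<lambda>x. restrict (\<lambda>i. x i) I)
     (PiM K (\<lambda>_. count_space UNIV)) (\<lambda>x. restrict (\<lambda>i. x i) K)"
    by (rule coin.indep_var_restrict[OF indep_coordinates]) (use assms(3) in auto)
  from coin.indep_varD[OF this sets[OF assms(1)] sets[OF assms(2)], of A B]
  have "measure coin {x. restrict x I \<in> ?A \<and> restrict x K \<in> ?B} =
    measure coin {x. restrict x I \<in> ?A} * measure coin {x. restrict x K \<in> ?B}"
    by (simp add: vimage_def Int_def)
  moreover have "{x. restrict x I \<in> ?A \<and> restrict x K \<in> ?B} = A \<inter> B"
    "{x. restrict x I \<in> ?A} = A" "{x. restrict x K \<in> ?B} = B"
    using e[of I A, OF A] e[of K B, OF B] by blast+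
  ultimately show ?thesis by (simp only:)
qed

lemma expectation_coordinate:
  fixes f :: "bool \<Rightarrow> real"
  shows "(\<integral>w. f (w v) \<partial>coin) = (f True + f False) / 2"
proof -
  let ?B = "measure_pmf (bernoulli_pmf (1/2))"
  have m: "(\<lambda>x. x v) \<in> measurable coin ?B"
    using measurable_coin_component by simp
  have "(\<integral>w. f (w v) \<partial>coin) = (\<integral>b. f b \<partial>distr coin ?B (\<lambda>x. x v))"
    by (rule integral_distr[symmetric, OF m]) simp
  also have "distr coin ?B (\<lambda>x. x v) = ?B"
    using coords.PiM_component[of v] by (simp add: coin_def)
  finally show ?thesis by (simp add: field_simps)
qed

text \<open>Here \<open>a\<close> and \<open>b\<close> are the weighted numbers of mismatches at one
  site for the two values of its coin; only their sum, the weighted occupation, is controlled. That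
  \<open>(1 - exp (- a)) * (1 - exp (- b))\<close> is nonnegative reduces the claim to
  \<open>t = a + b\<close> in \<open>[0, 1]\<close>, where
  \<open>exp (- t) \<le> 1 - t / 2\<close>.\<close>

lemma exp_average_le:
  fixes a b :: real
  assumes "0 \<le> a" "0 \<le> b" "a + b \<le> 1"
  shows "(exp (- a) + exp (- b)) / 2 \<le> exp (- (a + b) / 4)"
proof -
  let ?t = "a + b"
  have "0 \<le> (1 - exp (- a)) * (1 - exp (- b))"
    using assms by simp
  then have "exp (- a) + exp (- b) \<le> 1 + exp (- ?t)"
    by (simp add: algebra_simps exp_add[symmetric])
  moreover have "exp (- ?t) \<le> 1 - ?t / 2"
  proof -
    have "exp (- ?t) = 1 / exp ?t" by (simp only: exp_minus inverse_eq_divide)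
    also have "\<dots> \<le> 1 / (1 + ?t)"
      using assms exp_ge_add_one_self[of ?t] by (intro divide_left_mono) auto
    also have "\<dots> \<le> 1 - ?t / 2"
    proof -
      have "?t * ?t \<le> ?t * 1" using assms by (intro mult_left_mono) auto
      then have "1 \<le> (1 - ?t / 2) * (1 + ?t)" by (simp add: algebra_simps)
      then show ?thesis using assms by (simp add: pos_divide_le_eq)
    qed
    finally show ?thesis .
  qed
  moreover have "1 - ?t / 4 \<le> exp (- ?t / 4)"
    using exp_ge_add_one_self[of "- ?t / 4"] by linarith
  ultimately show ?thesis by simp
qed

text \<open>A Chernoff bound, with the exponential weight \<open>1/L\<close> matched to the maximal occupation \<open>L\<close>.\<close>

lemma scenery_ball_bound:
  fixes s :: "nat \<Rightarrow> nat" and u :: "nat \<Rightarrow> bool"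
  assumes "0 < L" and occ: "\<And>v. card {k. k < N \<and> s k = v} \<le> L"
  shows "measure coin {w. real (card {k. k < N \<and> u k \<noteq> w (s k)}) < real N / 8}
    \<le> exp (- (real N / (8 * real L)))"
proof -
  define l where "l = 1 / real L"
  have l: "0 < l" using assms by (simp add: l_def)
  define V where "V = s ` {..<N}"
  \<comment> \<open>Mismatches are grouped by site: \<open>h v b\<close> counts those at
    \<open>v\<close> if the coin there shows \<open>b\<close>. Distinct sites then contribute
    independent summands.\<close>
  define h where "h v b = card {k. k < N \<and> s k = v \<and> u k \<noteq> b}" for v b
  define D where "D w = real (card {k. k < N \<and> u k \<noteq> w (s k)})" for w :: "nat \<Rightarrow> bool"
  have [simp]: "finite V" by (simp add: V_def)
  have D: "D w = (\<Sum>v\<in>V. real (h v (w v)))" for w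
  proof -
    have "{k. k < N \<and> u k \<noteq> w (s k)} = (\<Union>v\<in>V. {k. k < N \<and> s k = v \<and> u k \<noteq> w v})"
      by (auto simp: V_def)
    then have "card {k. k < N \<and> u k \<noteq> w (s k)} = (\<Sum>v\<in>V. card {k. k < N \<and> s k = v \<and> u k \<noteq> w v})"
      by (simp only:) (rule card_UN_disjoint, auto)
    then show ?thesis by (simp add: D_def h_def)
  qed
  have hsum: "h v True + h v False = card {k. k < N \<and> s k = v}" for v
  proof -
    have "{k. k < N \<and> s k = v} = {k. k < N \<and> s k = v \<and> u k \<noteq> True} \<union> {k. k < N \<and> s k = v \<and> u k \<noteq> False}"
      by auto
    then show ?thesis unfolding h_def by (simp only:) (rule card_Un_disjoint[symmetric], auto)
  qed
  have total: "(\<Sum>v\<in>V. card {k. k < N \<and> s k = v}) = N"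
  proof -
    have "card (\<Union>v\<in>V. {k. k < N \<and> s k = v}) = (\<Sum>v\<in>V. card {k. k < N \<and> s k = v})"
      by (rule card_UN_disjoint) auto
    moreover have "(\<Union>v\<in>V. {k. k < N \<and> s k = v}) = {..<N}" by (auto simp: V_def)
    ultimately show ?thesis by simp
  qed
  have ind: "coin.indep_vars (\<lambda>_. borel) (\<lambda>v w. exp (- l * real (h v (w v)))) V"
    by (rule coin.indep_vars_compose2[OF coin.indep_vars_subset[OF indep_coordinates]]) auto
  have int: "integrable coin (\<lambda>w. exp (- l * real (h v (w v))))" for v
    by (rule coin.integrable_const_bound[of _ 1])
      (use l in \<open>auto intro!: measurable_compose[OF measurable_coin_component]\<close>)
  have intD: "integrable coin (\<lambda>w. \<Prod>v\<in>V. exp (- l * real (h v (w v))))"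
    by (rule coin.indep_vars_integrable[OF _ ind int]) simp
  have prodD: "(\<Prod>v\<in>V. exp (- l * real (h v (w v)))) = exp (- l * D w)" for w
    by (simp add: D exp_sum[symmetric] sum_distrib_left sum_negf)
  have mD: "{w. D w < real N / 8} \<in> sets coin"
    by (rule sets_coin_finite[of "V"]) (auto simp: D)
  have "measure coin {w. D w < real N / 8} = (\<integral>w. indicator {w. D w < real N / 8} w \<partial>coin)"
    using mD by simp
  \<comment> \<open>Exponential Markov inequality with weight \<open>l\<close>.\<close>
  also have "\<dots> \<le> (\<integral>w. exp (l * (real N / 8)) * (\<Prod>v\<in>V. exp (- l * real (h v (w v)))) \<partial>coin)"
  proof (rule integral_mono)
    show "indicator {w. D w < real N / 8} w \<le> exp (l * (real N / 8)) * (\<Prod>v\<in>V. exp (- l * real (h v (w v))))" for w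
    proof (cases "D w < real N / 8")
      case True
      then have "0 \<le> l * (real N / 8) + - l * D w"
        using l by (simp add: algebra_simps mult_left_mono)
      then show ?thesis
        unfolding prodD exp_add[symmetric] using True by simp
    next
      case False
      then show ?thesis unfolding prodD by simp
    qed
  qed (use mD intD in \<open>auto intro!: integrable_real_indicator coin.emeasure_finite simp: less_top[symmetric]\<close>)
  also have "\<dots> = exp (l * (real N / 8)) * (\<Prod>v\<in>V. (exp (- l * real (h v True)) + exp (- l * real (h v False))) / 2)"
    using coin.indep_vars_lebesgue_integral[OF _ ind int] 
    by (simp add: expectation_coordinate[of "\<lambda>b. exp (- (l * real (h _ b)))"])
  also have "\<dots> \<le> exp (l * (real N / 8)) * (\<Prod>v\<in>V. exp (- (l * card {k. k < N \<and> s k = v}) / 4))"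
  proof (intro mult_left_mono prod_mono conjI)
    fix v
    have "l * real (h v True) + l * real (h v False) = l * card {k. k < N \<and> s k = v}"
      unfolding hsum[symmetric] by (simp add: algebra_simps)
    \<comment> \<open>The choice \<open>l = 1 / L\<close> makes the weighted occupation of every
      site at most one, the range of \<open>exp_average_le\<close>.\<close>
    moreover have "l * card {k. k < N \<and> s k = v} \<le> 1"
      using occ[of v] assms(1) by (simp add: l_def)
    ultimately show "(exp (- l * real (h v True)) + exp (- l * real (h v False))) / 2
        \<le> exp (- (l * card {k. k < N \<and> s k = v}) / 4)"
      using exp_average_le[of "l * real (h v True)" "l * real (h v False)"] l by simp
  qed auto
  also have "(\<Prod>v\<in>V. exp (- (l * card {k. k < N \<and> s k = v}) / 4)) = exp (- l * real N / 4)"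
  proof -
    have "(\<Prod>v\<in>V. exp (- (l * card {k. k < N \<and> s k = v}) / 4)) =
      exp (\<Sum>v\<in>V. - (l * card {k. k < N \<and> s k = v}) / 4)"
      by (simp add: exp_sum)
    also have "(\<Sum>v\<in>V. - (l * card {k. k < N \<and> s k = v}) / 4) = - l / 4 * real (\<Sum>v\<in>V. card {k. k < N \<and> s k = v})"
      by (simp add: sum_distrib_left)
    finally show ?thesis by (simp add: total)
  qed
  \<comment> \<open>The gain \<open>l * N / 4\<close> from the sites beats the cost
    \<open>l * N / 8\<close> of the threshold; the radius 1/8 leaves this margin.\<close>
  also have "exp (l * (real N / 8)) * exp (- l * real N / 4) = exp (- (real N / (8 * real L)))"
    by (simp add: exp_add[symmetric] l_def field_simps)
  finally show ?thesis by (simp add: D_def)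
qed

section \<open>The skew product over the odometer\<close>

definition flip :: "nat \<Rightarrow> (nat \<Rightarrow> bool) \<Rightarrow> nat \<Rightarrow> bool" where
  "flip n w v = w (v XOR n)"

lemma xor_xor_cancel [simp]: "(v XOR n) XOR n = (v :: nat)"
  by (simp add: xor.assoc)

lemma flip_0 [simp]: "flip 0 = id"
  by (intro ext) (simp add: flip_def)

lemma flip_flip: "flip m (flip n w) = flip (n XOR m) w"
  by (intro ext) (simp add: flip_def xor.assoc xor.commute[of m n])

lemma flip_cancel [simp]: "flip n (flip n w) = w"
  by (intro ext) (simp add: flip_def)

lemma measurable_flip [measurable]: "flip n \<in> measurable coin coin"
  unfolding flip_def by (rule measurable_into_coin) measurable

lemma distr_flip: "distr coin coin (flip n) = coin"
proof -
  have "inj (\<lambda>v::nat. v XOR n)"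
    by (rule inj_on_inverseI[where g="\<lambda>v. v XOR n"]) simp
  then have "distr coin coin (\<lambda>w. \<lambda>v\<in>UNIV. w (v XOR n)) = coin"
    unfolding coin_def by (intro distr_PiM_reindex) (auto intro: measure_pmf.prob_space_axioms)
  then show ?thesis by (simp add: flip_def[abs_def] restrict_UNIV)
qed

abbreviation model :: "((nat \<Rightarrow> bool) \<times> (nat \<Rightarrow> bool)) measure" where
  "model \<equiv> coin \<Otimes>\<^sub>M coin"

interpretation model: pair_prob_space coin coin
  by unfold_locales

lemma space_model [simp]: "space model = UNIV"
  by (simp add: space_pair_measure)

text \<open>The fibre is a random scenery on the group \<open>(\<nat>, XOR)\<close> instead of \<open>\<int>\<close>: with this choice the
  cocycle over the odometer is just the set of changed bits outside \<open>E\<close>, see \<open>bit_shift\<close>.\<close>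

definition skew :: "nat set \<Rightarrow> (nat \<Rightarrow> bool) \<times> (nat \<Rightarrow> bool) \<Rightarrow> (nat \<Rightarrow> bool) \<times> (nat \<Rightarrow> bool)" where
  "skew E = (\<lambda>(x, w). (odometer 0 x, flip (shift_step E x) w))"

definition skew_inv :: "nat set \<Rightarrow> (nat \<Rightarrow> bool) \<times> (nat \<Rightarrow> bool) \<Rightarrow> (nat \<Rightarrow> bool) \<times> (nat \<Rightarrow> bool)" where
  "skew_inv E = (\<lambda>(x, w). (odometer_inv x, flip (shift_step E (odometer_inv x)) w))"

lemma skew_inverse [simp]: "skew E (skew_inv E y) = y" "skew_inv E (skew E y) = y"
  by (auto simp: skew_def skew_inv_def split: prod.splits)

lemma skew_funpow: "(skew E ^^ k) (x, w) = ((odometer 0 ^^ k) x, flip (site_shift E k x) w)"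
  by (induction k) (auto simp: skew_def flip_flip)

lemma measurable_fibre:
  assumes [measurable]: "c \<in> measurable M (count_space UNIV)" "g \<in> measurable M coin"
  shows "(\<lambda>p. flip (c p) (g p)) \<in> measurable M coin"
  by (rule measurable_compose_countable[where f="\<lambda>n p. flip n (g p)"]) auto

lemma measurable_skew [measurable]: "skew E \<in> measurable model model"
  unfolding skew_def case_prod_beta
  by (intro measurable_Pair measurable_fibre) measurable

lemma measurable_skew_inv [measurable]: "skew_inv E \<in> measurable model model"
  unfolding skew_inv_def case_prod_beta
  by (intro measurable_Pair measurable_fibre) measurable

lemma distr_skew: "distr model model (skew E) = model"
proof (rule measure_eqI)
  fix A assume "A \<in> sets (distr model model (skew E))"
  then have [measurable]: "A \<in> sets model" by simp
  have [measurable]: "(\<lambda>x. emeasure coin (Pair x -` A)) \<in> borel_measurable coin"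
    by (rule coin.measurable_emeasure_Pair) simp
  have fib: "emeasure coin (flip n -` B) = emeasure coin B" if "B \<in> sets coin" for n B
    using emeasure_distr[OF measurable_flip that, of n] by (simp add: distr_flip)
  have v: "skew E -` A \<in> sets model"
    using measurable_sets[OF measurable_skew[of E], of A] by simp
  have "emeasure (distr model model (skew E)) A = emeasure model (skew E -` A)"
    by (subst emeasure_distr) auto
  also have "\<dots> = (\<integral>\<^sup>+x. emeasure coin (Pair x -` (skew E -` A)) \<partial>coin)"
    using v by (rule coin.emeasure_pair_measure_alt)
  also have "\<dots> = (\<integral>\<^sup>+x. emeasure coin (Pair (odometer 0 x) -` A) \<partial>coin)"
  proof (rule nn_integral_cong)
    fix x
    have "Pair x -` (skew E -` A) = flip (shift_step E x) -` (Pair (odometer 0 x) -` A)"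
      by (auto simp: skew_def)
    then show "emeasure coin (Pair x -` (skew E -` A)) = emeasure coin (Pair (odometer 0 x) -` A)"
      by (simp add: fib sets_Pair1)
  qed
  also have "\<dots> = (\<integral>\<^sup>+x. emeasure coin (Pair x -` A) \<partial>distr coin coin (odometer 0))"
    by (rule nn_integral_distr[symmetric]) auto
  also have "\<dots> = emeasure model A"
    unfolding distr_odometer by (rule coin.emeasure_pair_measure_alt[symmetric]) simp
  finally show "emeasure (distr model model (skew E)) A = emeasure model A" .
qed simp

text \<open>The window \<open>2 ^ J\<close> for the sites is a power of two, so that it is closed under \<open>XOR\<close>.\<close>

definition depends :: "nat \<Rightarrow> ((nat \<Rightarrow> bool) \<times> (nat \<Rightarrow> bool)) set \<Rightarrow> bool" where
  "depends J C \<longleftrightarrow> (\<forall>x w x' w'. (\<forall>i<J. x i = x' i) \<longrightarrow> (\<forall>v<2 ^ J. w v = w' v) \<longrightarrow>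
     ((x, w) \<in> C \<longleftrightarrow> (x', w') \<in> C))"

lemma dependsD:
  "depends J C \<Longrightarrow> (\<And>i. i < J \<Longrightarrow> x i = x' i) \<Longrightarrow> (\<And>v. v < 2 ^ J \<Longrightarrow> w v = w' v) \<Longrightarrow>
   (x, w) \<in> C \<longleftrightarrow> (x', w') \<in> C"
  unfolding depends_def by blast

lemma depends_mono:
  assumes "depends J C" "J \<le> K"
  shows "depends K C"
proof -
  have "(2::nat) ^ J \<le> 2 ^ K" using assms(2) by simp
  then have "v < 2 ^ K" if "v < 2 ^ J" for v :: nat using that by linarith
  then show ?thesis
    using assms(2) unfolding depends_def
    by (intro allI impI dependsD[OF assms(1)]) auto
qed

lemma depends_Compl: "depends J C \<Longrightarrow> depends J (- C)"
  unfolding depends_def by (simp only: Compl_iff) blast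

lemma depends_Un: "depends J C \<Longrightarrow> depends J D \<Longrightarrow> depends J (C \<union> D)"
  unfolding depends_def by (simp only: Un_iff) blast

section \<open>Events in a finite window and their density\<close>

lemma measurable_val [measurable]: "val m \<in> measurable coin (count_space UNIV)"
  by (rule measurable_coin_finite[of "{..<m}"]) (auto simp: val_eq_iff)

text \<open>The \<open>val\<close> codes of the \<open>J\<close> bits and of the
  \<open>2 ^ J\<close> sites map to a countable discrete space, and \<open>C\<close> is a union of
  fibres of the pair.\<close>

lemma sets_depends:
  assumes "depends J C"
  shows "C \<in> sets model"
proof -
  let ?g = "\<lambda>p. (val J (fst p), val (2 ^ J) (snd p))"
  have [measurable]: "?g \<in> measurable model (count_space UNIV)"
  proof -
    have "?g \<in> measurable model (count_space UNIV \<Otimes>\<^sub>M count_space UNIV)"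
      by (intro measurable_Pair) measurable
    then show ?thesis by (simp add: pair_measure_countable)
  qed
  have "C = ?g -` (?g ` C) \<inter> space model"
  proof (intro equalityI subsetI)
    fix p assume "p \<in> ?g -` (?g ` C) \<inter> space model"
    then obtain q where "q \<in> C" "?g p = ?g q" by blast
    then show "p \<in> C"
      using dependsD[OF assms, of "fst p" "fst q" "snd p" "snd q"] by (simp add: val_eq_iff)
  qed simp
  also have "\<dots> \<in> sets model" by (rule measurable_sets[of ?g model "count_space UNIV"]) auto
  finally show ?thesis .
qed

lemma sets_model_generated:
  "sets model \<subseteq> sigma_sets UNIV (range (\<lambda>i. {p. fst p i}) \<union> range (\<lambda>v. {p. snd p v}))"
    (is "_ \<subseteq> sigma_sets UNIV ?G")
proof
  fix A assume A: "A \<in> sets model"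
  let ?S = "sigma UNIV ?G"
  have S: "space ?S = UNIV" "sets ?S = sigma_sets UNIV ?G" by auto
  have m: "(\<lambda>p. P p) \<in> measurable ?S (count_space UNIV)" if "{p. P p} \<in> ?G" for P
  proof -
    have "{p \<in> space ?S. P p} \<in> sets ?S" using that S by (auto intro: sigma_sets.Basic)
    then show ?thesis by (simp only: pred_def[symmetric])
  qed
  have "(\<lambda>p. (fst p, snd p)) \<in> measurable ?S model"
    by (intro measurable_Pair measurable_into_coin m) auto
  then have "(\<lambda>p. (fst p, snd p)) -` A \<inter> space ?S \<in> sets ?S"
    using A by (rule measurable_sets)
  then show "A \<in> sigma_sets UNIV ?G" by simp
qed

text \<open>The approximable sets form a sigma algebra: complements have the same symmetric
  difference, and a countable union is cut off at a finite stage, half of the error going to the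
  tail.\<close>

lemma model_approximation:
  assumes "A \<in> sets model" "0 < \<epsilon>"
  shows "\<exists>J C. depends J C \<and> measure model (sym_diff A C) < \<epsilon>"
proof -
  let ?G = "range (\<lambda>i. {p. fst p i}) \<union> range (\<lambda>v. {p :: (nat \<Rightarrow> bool) \<times> (nat \<Rightarrow> bool). snd p v})"
  define good where "good A \<longleftrightarrow> A \<in> sets model \<and> (\<forall>e>0. \<exists>J C. depends J C \<and> measure model (sym_diff A C) < e)" for A
  have dep: "good C" if "depends J C" for J C
    using that sets_depends[OF that] unfolding good_def by (auto intro!: exI[of _ J] exI[of _ C])
  have un: "good (A \<union> B)" if gA: "good A" and gB: "good B" for A B
    unfolding good_def
  proof safe
    show "A \<union> B \<in> sets model" using gA gB by (auto simp: good_def)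
    fix e :: real assume "0 < e"
    then have "0 < e / 2" by simp
    obtain J C where C: "depends J C" "measure model (sym_diff A C) < e / 2"
      using gA \<open>0 < e / 2\<close> unfolding good_def by blast
    obtain K D where D: "depends K D" "measure model (sym_diff B D) < e / 2"
      using gB \<open>0 < e / 2\<close> unfolding good_def by blast
    have [measurable]: "A \<in> sets model" "B \<in> sets model" "C \<in> sets model" "D \<in> sets model"
      using gA gB C D by (auto simp: good_def sets_depends)
    have "measure model (sym_diff (A \<union> B) (C \<union> D)) \<le> measure model (sym_diff A C \<union> sym_diff B D)"
      by (rule model.P.finite_measure_mono) auto
    also have "\<dots> \<le> measure model (sym_diff A C) + measure model (sym_diff B D)"
      by (rule measure_Un_le) auto
    also have "\<dots> < e" using C D by simp
    finally have "measure model (sym_diff (A \<union> B) (C \<union> D)) < e" .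
    moreover have "depends (max J K) (C \<union> D)"
      using C D by (intro depends_Un) (auto intro: depends_mono)
    ultimately show "\<exists>J C. depends J C \<and> measure model (sym_diff (A \<union> B) C) < e" by blast
  qed
  have "good A" if "A \<in> sigma_sets UNIV ?G" for A
    using that
  proof induction
    case (Basic A)
    then consider i where "A = {p. fst p i}" | v where "A = {p. snd p v}" by auto
    then show ?case
    proof cases
      case 1
      then show ?thesis by (intro dep[of "Suc i"]) (auto simp: depends_def)
    next
      case 2
      \<comment> \<open>The window with \<open>J = v\<close> already contains the site
        \<open>v\<close>.\<close>
      have "v < 2 ^ v" by simp
      then show ?thesis using 2 by (intro dep[of v]) (auto simp: depends_def)
    qed
  next
    case Empty
    show ?case by (rule dep[of 0]) (simp add: depends_def)
  next
    case (Compl A)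
    have "sym_diff (- A) (- C) = sym_diff A C" for C by auto
    then have "good (- A)"
      using Compl depends_Compl unfolding good_def by (metis Compl_eq_Diff_UNIV sets.compl_sets space_model)
    then show ?case by (simp add: Compl_eq_Diff_UNIV)
  next
    case (Union A)
    let ?U = "\<lambda>n. \<Union>i\<le>n. A i"
    have U: "good (?U n)" for n
      by (induction n) (auto simp: atMost_Suc intro: un Union.IH)
    have [measurable]: "A i \<in> sets model" for i using Union.IH by (auto simp: good_def)
    show ?case
      unfolding good_def
    proof safe
      fix e :: real assume "0 < e"
      then have e: "0 < e / 2" by simp
      have "(\<lambda>n. measure model (?U n)) \<longlonglongrightarrow> measure model (\<Union>n. ?U n)"
        by (rule model.P.finite_Lim_measure_incseq) (auto simp: incseq_def intro: order_trans)
      moreover have "(\<Union>n. ?U n) = (\<Union>n. A n)" by auto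
      ultimately have "(\<lambda>n. measure model (?U n)) \<longlonglongrightarrow> measure model (\<Union>n. A n)" by simp
      from LIMSEQ_D[OF this e] obtain n
        where "norm (measure model (?U n) - measure model (\<Union>n. A n)) < e / 2"
        by blast
      then have n: "measure model (\<Union>n. A n) - measure model (?U n) < e / 2"
        by (simp only: real_norm_def)
      from U[of n] e obtain J C where C: "depends J C" "measure model (sym_diff (?U n) C) < e / 2"
        unfolding good_def by blast
      have [measurable]: "C \<in> sets model" using C by (simp add: sets_depends)
      have "measure model (sym_diff (\<Union>n. A n) C) \<le> measure model (((\<Union>n. A n) - ?U n) \<union> sym_diff (?U n) C)"
        by (rule model.P.finite_measure_mono) auto
      also have "\<dots> \<le> measure model ((\<Union>n. A n) - ?U n) + measure model (sym_diff (?U n) C)"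
        by (rule measure_Un_le) auto
      also have "measure model ((\<Union>n. A n) - ?U n) = measure model (\<Union>n. A n) - measure model (?U n)"
        by (rule model.P.finite_measure_Diff) auto
      finally show "\<exists>J C. depends J C \<and> measure model (sym_diff (\<Union>n. A n) C) < e"
        using n C by (intro exI[of _ J] exI[of _ C]) auto
    qed auto
  qed
  then have "good A" using assms(1) sets_model_generated by blast
  then show ?thesis using assms(2) by (auto simp: good_def)
qed

section \<open>Fibrewise estimates for the skew product\<close>

lemma measurable_measure_slice:
  assumes "A \<in> sets model"
  shows "(\<lambda>x. measure coin (Pair x -` A)) \<in> borel_measurable coin"
  unfolding measure_def
  by (rule borel_measurable_enn2real, rule coin.measurable_emeasure_Pair) fact

lemma integrable_measure_slice:
  assumes "A \<in> sets model"
  shows "integrable coin (\<lambda>x. measure coin (Pair x -` A))"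
  by (rule coin.integrable_const_bound[of _ 1]) (auto intro: measurable_measure_slice assms)

lemma measure_model:
  assumes "A \<in> sets model"
  shows "measure model A = (\<integral>x. measure coin (Pair x -` A) \<partial>coin)"
proof -
  have "emeasure model A = (\<integral>\<^sup>+x. ennreal (measure coin (Pair x -` A)) \<partial>coin)"
    by (subst coin.emeasure_pair_measure_alt[OF assms]) (simp add: coin.emeasure_eq_measure)
  also have "\<dots> = ennreal (\<integral>x. measure coin (Pair x -` A) \<partial>coin)"
    by (intro nn_integral_eq_integral integrable_measure_slice assms) simp
  finally show ?thesis
    by (simp add: model.P.emeasure_eq_measure integral_nonneg_AE)
qed

lemma xor_less_power: "(a::nat) < 2 ^ n \<Longrightarrow> b < 2 ^ n \<Longrightarrow> a XOR b < 2 ^ n"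
  by (metis take_bit_nat_eq_self_iff take_bit_xor)

lemma skew_funpow_slice:
  "Pair x -` ((skew E ^^ k) -` A) = flip (site_shift E k x) -` (Pair ((odometer 0 ^^ k) x) -` A)"
  by (auto simp: skew_funpow)

lemma measurable_skew_funpow [measurable]: "skew E ^^ k \<in> measurable model model"
  by (rule measurable_compose_n) simp

lemma measurable_odometer_funpow [measurable]: "odometer 0 ^^ k \<in> measurable coin coin"
  by (rule measurable_compose_n) simp

lemma vimage_skew_funpow: "A \<in> sets model \<Longrightarrow> (skew E ^^ k) -` A \<in> sets model"
  using measurable_sets[OF measurable_skew_funpow, of A k E] by simp

lemma measure_flip:
  assumes "B \<in> sets coin"
  shows "measure coin (flip n -` B) = measure coin B"
  using measure_distr[OF measurable_flip assms, of n] by (simp add: distr_flip)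

text \<open>As soon as the shift exceeds the window \<open>2^J\<close>, the two copies of \<open>C\<close> look at disjoint sets of
  sites and are independent.\<close>

lemma slice_correlation:
  assumes "depends J C"
  shows "measure coin (Pair x -` (C \<inter> (skew E ^^ k) -` C)) \<le>
    measure coin (Pair x -` C) * measure coin (Pair ((odometer 0 ^^ k) x) -` C) +
    of_bool (site_shift E k x < 2 ^ J)"
proof (cases "site_shift E k x < 2 ^ J")
  case True
  have "measure coin (Pair x -` (C \<inter> (skew E ^^ k) -` C)) \<le> 1" by simp
  then show ?thesis using True by (simp add: add_increasing)
next
  case False
  define n where "n = site_shift E k x"
  let ?A = "Pair x -` C" and ?B = "Pair ((odometer 0 ^^ k) x) -` C"
  have "v \<noteq> u XOR n" if "v < 2 ^ J" "u < 2 ^ J" for u v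
  proof
    assume "v = u XOR n"
    then have "n = u XOR v" by (simp add: xor.assoc[symmetric])
    then show False using xor_less_power[OF that(2,1)] False by (simp add: n_def)
  qed
  then have disj: "{..<2 ^ J} \<inter> (\<lambda>v. v XOR n) ` {..<2 ^ J} = {}" by auto
  have "measure coin (?A \<inter> flip n -` ?B) = measure coin ?A * measure coin (flip n -` ?B)"
  proof (rule prob_Int_disjoint_coordinates[OF _ _ disj])
    show "w \<in> ?A \<longleftrightarrow> w' \<in> ?A" if "\<And>i. i \<in> {..<2 ^ J} \<Longrightarrow> w i = w' i" for w w'
      using that dependsD[OF assms, of x x w w'] by simp
    show "w \<in> flip n -` ?B \<longleftrightarrow> w' \<in> flip n -` ?B"
      if "\<And>i. i \<in> (\<lambda>v. v XOR n) ` {..<2 ^ J} \<Longrightarrow> w i = w' i" for w w'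
      using that dependsD[OF assms, of "(odometer 0 ^^ k) x" "(odometer 0 ^^ k) x" "flip n w" "flip n w'"]
      by (simp add: flip_def)
  qed auto
  also have "measure coin (flip n -` ?B) = measure coin ?B"
    by (intro measure_flip sets_Pair1[of C coin] sets_depends[OF assms])
  finally show ?thesis
    using False by (simp add: vimage_Int skew_funpow_slice n_def)
qed

text \<open>Independence on average over \<open>2 ^ m\<close> steps. By
  \<open>slice_correlation\<close> the correlation at time \<open>k\<close> is a product of fibre
  measures unless the shift lies in the window, whose \<open>2 ^ J\<close> sites are visited at most
  \<open>2 ^ card (E \<inter> {..<m})\<close> times each. The products have a sum that is
  independent of the orbit in the second factor, because the odometer meets each residue
  once.\<close>

lemma skew_average:
  assumes C: "depends J C" and "J \<le> m"
  shows "(\<Sum>k<2 ^ m. measure model (C \<inter> (skew E ^^ k) -` C)) \<le>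
    2 ^ m * (measure model C)\<^sup>2 + 2 ^ J * 2 ^ card (E \<inter> {..<m})"
proof -
  define p where "p x = measure coin (Pair x -` C)" for x
  \<comment> \<open>\<open>bit c\<close> is the sequence with residue \<open>c\<close> and zeros
    from \<open>m\<close> on; since \<open>J \<le> m\<close>, \<open>p\<close> cannot tell it from
    an orbit point with the same residue.\<close>
  define Z where "Z = (\<Sum>c<(2::nat) ^ m. p (bit c))"
  have [measurable]: "C \<in> sets model" by (rule sets_depends[OF C])
  have CC: "C \<inter> (skew E ^^ k) -` C \<in> sets model" for k
    by (intro sets.Int vimage_skew_funpow) auto
  have p_int: "integrable coin p"
    unfolding p_def by (rule integrable_measure_slice) simp
  have p_int_k: "integrable coin (\<lambda>x. p ((odometer 0 ^^ k) x))"
    and p_k: "(\<integral>x. p ((odometer 0 ^^ k) x) \<partial>coin) = measure model C" for k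
  proof -
    have m: "p \<in> borel_measurable coin" using p_int by simp
    show "integrable coin (\<lambda>x. p ((odometer 0 ^^ k) x))"
      by (rule integrable_distr[of _ _ coin]) (simp_all add: distr_odometer_funpow p_int)
    show "(\<integral>x. p ((odometer 0 ^^ k) x) \<partial>coin) = measure model C"
      using integral_distr[OF measurable_odometer_funpow m, of k] measure_model[OF \<open>C \<in> sets model\<close>]
      by (simp add: distr_odometer_funpow p_def[symmetric])
  qed
  have p_cong: "p x = p y" if "\<And>i. i < J \<Longrightarrow> x i = y i" for x y
  proof -
    have "Pair x -` C = Pair y -` C" using dependsD[OF C that] by auto
    then show ?thesis by (simp add: p_def)
  qed
  have Z: "(\<Sum>k<(2::nat) ^ m. p ((odometer 0 ^^ k) x)) = Z" for x
  proof -
    have "p ((odometer 0 ^^ k) x) = p (bit (val m ((odometer 0 ^^ k) x)))" for k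
      by (rule p_cong) (use \<open>J \<le> m\<close> in \<open>auto simp: bit_val\<close>)
    then show ?thesis
      unfolding Z_def by (simp only: sum.reindex_bij_betw[OF bij_betw_val_odometer, of "\<lambda>c. p (bit c)"])
  qed
  have "Z = (\<integral>x. (\<Sum>k<2 ^ m. p ((odometer 0 ^^ k) x)) \<partial>coin)"
    unfolding Z by simp
  also have "\<dots> = 2 ^ m * measure model C"
    by (subst Bochner_Integration.integral_sum) (auto simp: p_int_k p_k)
  finally have Z_eq: "Z = 2 ^ m * measure model C" .
  have "(\<Sum>k<2 ^ m. measure model (C \<inter> (skew E ^^ k) -` C)) =
    (\<integral>x. (\<Sum>k<2 ^ m. measure coin (Pair x -` (C \<inter> (skew E ^^ k) -` C))) \<partial>coin)"
    by (simp only: measure_model[OF CC], rule Bochner_Integration.integral_sum[symmetric],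
      rule integrable_measure_slice[OF CC])
  also have "\<dots> \<le> (\<integral>x. p x * Z + 2 ^ J * 2 ^ card (E \<inter> {..<m}) \<partial>coin)"
  proof (rule integral_mono_AE)
    show "integrable coin (\<lambda>x. \<Sum>k<2 ^ m. measure coin (Pair x -` (C \<inter> (skew E ^^ k) -` C)))"
      by (intro Bochner_Integration.integrable_sum integrable_measure_slice CC)
    show "integrable coin (\<lambda>x. p x * Z + 2 ^ J * 2 ^ card (E \<inter> {..<m}))"
      by (intro Bochner_Integration.integrable_add integrable_mult_left p_int) simp
    show "AE x in coin. (\<Sum>k<2 ^ m. measure coin (Pair x -` (C \<inter> (skew E ^^ k) -` C))) \<le>
        p x * Z + 2 ^ J * 2 ^ card (E \<inter> {..<m})"
      using AE_no_overflow
    proof eventually_elim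
      case (elim x)
      have "(\<Sum>k<2 ^ m. measure coin (Pair x -` (C \<inter> (skew E ^^ k) -` C))) \<le>
        (\<Sum>k<2 ^ m. p x * p ((odometer 0 ^^ k) x) + of_bool (site_shift E k x < 2 ^ J))"
        unfolding p_def by (intro sum_mono slice_correlation[OF C])
      also have "\<dots> = p x * Z + real (card {k. k < 2 ^ m \<and> site_shift E k x < 2 ^ J})"
      proof -
        have "{..<2 ^ m} \<inter> {k. site_shift E k x < 2 ^ J} = {k. k < 2 ^ m \<and> site_shift E k x < 2 ^ J}" by auto
        then show ?thesis
          by (simp add: sum.distrib sum_distrib_left[symmetric] Z of_bool_def sum.If_cases)
      qed
      also have "card {k. k < 2 ^ m \<and> site_shift E k x < 2 ^ J} \<le> 2 ^ J * 2 ^ card (E \<inter> {..<m})"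
      proof -
        have "{k. k < 2 ^ m \<and> site_shift E k x < 2 ^ J} =
            (\<Union>v\<in>{..<2 ^ J}. {k. k < 2 ^ m \<and> site_shift E k x = v})" by auto
        then have "card {k. k < 2 ^ m \<and> site_shift E k x < 2 ^ J} \<le>
            (\<Sum>v<2 ^ J. card {k. k < 2 ^ m \<and> site_shift E k x = v})"
          by (simp only:) (rule card_UN_le, simp)
        also have "\<dots> \<le> (\<Sum>v<(2::nat) ^ J. 2 ^ card (E \<inter> {..<m}))"
          by (intro sum_mono shift_occupation[OF elim])
        finally show ?thesis by simp
      qed
      finally show ?case by simp
    qed
  qed
  also have "\<dots> = measure model C * Z + 2 ^ J * 2 ^ card (E \<inter> {..<m})"
    using p_int p_k[of 0] by simp
  finally show ?thesis by (simp add: Z_eq power2_eq_square mult_ac)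
qed

text \<open>If some bit of the block is zero, the scenery is not translated at time
  \<open>2 ^ e\<close> and the bits below \<open>e\<close> are unchanged, so an event in the window
  \<open>J \<le> e\<close> sees no change. Only a block of \<open>n\<close> ones is
  exceptional.\<close>

lemma skew_almost_fixed:
  assumes C: "depends J C" and "J \<le> e" "{e..<e + n} \<subseteq> E"
  shows "measure model {y. ((skew E ^^ (2 ^ e)) y \<in> C) \<noteq> (y \<in> C)} \<le> (1 / 2) ^ n"
proof -
  let ?D = "{y. ((skew E ^^ (2 ^ e)) y \<in> C) \<noteq> (y \<in> C)}"
  let ?O = "{x. \<forall>j\<in>{e..<e + n}. x j = True}"
  have D: "?D = sym_diff ((skew E ^^ (2 ^ e)) -` C) C" by auto
  have sD: "?D \<in> sets model"
    unfolding D using sets_depends[OF C] by (intro sets.Un sets.Diff vimage_skew_funpow)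
  have O: "?O \<in> sets coin"
    by (rule sets_coin_finite[of "{e..<e + n}"]) auto
  have "measure model ?D = (\<integral>x. measure coin (Pair x -` ?D) \<partial>coin)"
    by (rule measure_model[OF sD])
  also have "\<dots> \<le> (\<integral>x. indicator ?O x \<partial>coin)"
  proof (rule integral_mono_AE)
    show "AE x in coin. measure coin (Pair x -` ?D) \<le> indicator ?O x"
      using AE_no_overflow
    proof eventually_elim
      case (elim x)
      show ?case
      proof (cases "x \<in> ?O")
        case False
        then obtain j where "j \<in> {e..<e + n}" "\<not> x j" by auto
        then have s: "site_shift E (2 ^ e) x = 0"
          using elim assms(3) by (intro shift_block) auto
        have "(skew E ^^ (2 ^ e)) (x, w) \<in> C \<longleftrightarrow> (x, w) \<in> C" for w
          unfolding skew_funpow s odometer_funpow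
          by (rule dependsD[OF C]) (use \<open>J \<le> e\<close> in \<open>auto simp: odometer_def\<close>)
        then have "Pair x -` ?D = {}" by auto
        then show ?thesis by simp
      qed simp
    qed
    show "integrable coin (\<lambda>x. measure coin (Pair x -` ?D))"
      by (rule integrable_measure_slice[OF sD])
    show "integrable coin (indicator ?O :: _ \<Rightarrow> real)"
      by (rule integrable_real_indicator[OF O]) (simp add: coin.emeasure_eq_measure)
  qed
  also have "\<dots> = (1 / 2) ^ n"
    using O prob_coordinates[of "{e..<e + n}" "\<lambda>_. True"] by simp
  finally show ?thesis .
qed

text \<open>Over a fixed base point the name is the scenery read along a fixed path of sites. The
  Chernoff bound is the same for all paths without overflow, so it survives integration over the
  base.\<close>

lemma skew_ball_bound:
  fixes u :: "nat \<Rightarrow> bool"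
  assumes "N \<le> 2 ^ m"
  shows "measure model {y. real (card {k. k < N \<and> u k \<noteq> snd ((skew E ^^ k) y) 0}) < real N / 8}
    \<le> exp (- (real N / (8 * 2 ^ card (E \<inter> {..<m}))))"
proof -
  let ?B = "{y. real (card {k. k < N \<and> u k \<noteq> snd ((skew E ^^ k) y) 0}) < real N / 8}"
  let ?b = "exp (- (real N / (8 * 2 ^ card (E \<inter> {..<m}))))"
  have [measurable]: "(\<lambda>y. snd ((skew E ^^ k) y) 0) \<in> measurable model (count_space UNIV)" for k
    by (rule measurable_compose[OF measurable_skew_funpow]) measurable
  have "{y \<in> space model. real (card {k. k < N \<and> u k \<noteq> snd ((skew E ^^ k) y) 0}) < real N / 8} \<in> sets model"
    by measurable
  then have sB: "?B \<in> sets model" by simp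
  have "measure model ?B = (\<integral>x. measure coin (Pair x -` ?B) \<partial>coin)"
    by (rule measure_model[OF sB])
  also have "\<dots> \<le> (\<integral>x. ?b \<partial>coin)"
  proof (rule integral_mono_AE)
    show "AE x in coin. measure coin (Pair x -` ?B) \<le> ?b"
      using AE_no_overflow
    proof eventually_elim
      case (elim x)
      have "Pair x -` ?B = {w. real (card {k. k < N \<and> u k \<noteq> w (site_shift E k x)}) < real N / 8}"
        by (simp add: skew_funpow flip_def)
      moreover have "card {k. k < N \<and> site_shift E k x = v} \<le> 2 ^ card (E \<inter> {..<m})" for v
      proof -
        have "card {k. k < N \<and> site_shift E k x = v} \<le> card {k. k < 2 ^ m \<and> site_shift E k x = v}"
          using assms by (intro card_mono) auto
        also have "\<dots> \<le> 2 ^ card (E \<inter> {..<m})" by (rule shift_occupation[OF elim])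
        finally show ?thesis .
      qed
      ultimately show ?case
        using scenery_ball_bound[of "2 ^ card (E \<inter> {..<m})" N "\<lambda>k. site_shift E k x" u] by simp
    qed
    show "integrable coin (\<lambda>x. measure coin (Pair x -` ?B))"
      by (rule integrable_measure_slice[OF sB])
  qed simp
  finally show ?thesis by simp
qed

section \<open>Isomorphisms modulo null sets\<close>

definition isomorphic_mod_null :: "'a measure \<Rightarrow> 'b measure \<Rightarrow> bool" where
  "isomorphic_mod_null A B \<longleftrightarrow> (\<exists>f g. f \<in> measurable A B \<and> g \<in> measurable B A \<and>
     distr A B f = B \<and> distr B A g = A \<and>
     (AE x in A. g (f x) = x) \<and> (AE y in B. f (g y) = y))"

lemma isomorphic_mod_null_sym: "isomorphic_mod_null A B \<Longrightarrow> isomorphic_mod_null B A"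
  unfolding isomorphic_mod_null_def by blast

lemma isomorphic_mod_null_trans:
  assumes "isomorphic_mod_null A B" "isomorphic_mod_null B C"
  shows "isomorphic_mod_null A C"
proof -
  obtain f g where fg: "f \<in> measurable A B" "g \<in> measurable B A" "distr A B f = B" "distr B A g = A"
    "AE x in A. g (f x) = x" "AE y in B. f (g y) = y"
    using assms(1) unfolding isomorphic_mod_null_def by blast
  obtain h k where hk: "h \<in> measurable B C" "k \<in> measurable C B" "distr B C h = C" "distr C B k = B"
    "AE x in B. k (h x) = x" "AE y in C. h (k y) = y"
    using assms(2) unfolding isomorphic_mod_null_def by blast
  have "AE x in A. k (h (f x)) = f x"
    using AE_distrD[OF fg(1), unfolded fg(3), OF hk(5)] .
  then have 1: "AE x in A. g (k (h (f x))) = x"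
    using fg(5) by eventually_elim simp
  have "AE x in C. f (g (k x)) = k x"
    using AE_distrD[OF hk(2), unfolded hk(4), OF fg(6)] .
  then have 2: "AE x in C. h (f (g (k x))) = x"
    using hk(6) by eventually_elim simp
  have d: "distr A C (h \<circ> f) = C" "distr C A (g \<circ> k) = A"
    using distr_distr[OF hk(1) fg(1)] distr_distr[OF fg(2) hk(2)] fg hk by simp_all
  show ?thesis
    unfolding isomorphic_mod_null_def
    by (rule exI[of _ "h \<circ> f"], rule exI[of _ "g \<circ> k"])
      (use 1 2 d measurable_comp[OF fg(1) hk(1)] measurable_comp[OF hk(2) fg(2)] in auto)
qed

section \<open>Reduction of atomless measures to the unit interval\<close>

text \<open>A measure on the whole line rather than on the interval, so that maps into and out of it
  are total Borel functions.\<close>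

definition uniform_real :: "real measure" where
  "uniform_real = distr (restrict_space lborel {0<..<1}) borel (\<lambda>x. x)"

lemma sets_uniform_real [simp, measurable_cong]: "sets uniform_real = sets borel"
  by (simp add: uniform_real_def)

lemma space_uniform_real [simp]: "space uniform_real = UNIV"
  by (simp add: uniform_real_def)

lemma measurable_id_uniform_real: "(\<lambda>x. x) \<in> measurable (restrict_space lborel {0<..<1::real}) borel"
  by (rule measurable_restrict_space1) simp

lemma AE_uniform_real: "AE u in uniform_real. 0 < u \<and> u < 1"
proof -
  have "AE u in restrict_space lborel {0<..<1::real}. 0 < u \<and> u < 1"
    by (subst AE_restrict_space_iff) auto
  then show ?thesis
    unfolding uniform_real_def by (subst AE_distr_iff[OF measurable_id_uniform_real]) auto
qed

text \<open>The isomorphism is the distribution function of the embedded measure; its inverse is the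
  quantile function.\<close>

lemma isomorphic_uniform_real:
  fixes \<psi> :: "'a \<Rightarrow> real"
  assumes "prob_space P" and \<psi>: "\<psi> \<in> borel_measurable P" and \<xi>: "\<xi> \<in> measurable borel P"
    and inv: "AE p in P. \<xi> (\<psi> p) = p"
    and atomless: "\<And>p. p \<in> space P \<Longrightarrow> {p} \<in> null_sets P"
  shows "isomorphic_mod_null P uniform_real"
proof -
  interpret P: prob_space P by fact
  define \<nu> where "\<nu> = distr P borel \<psi>"
  have sets_\<nu> [measurable_cong, simp]: "sets \<nu> = sets borel" by (simp add: \<nu>_def)
  have [simp]: "space \<nu> = UNIV" by (simp add: \<nu>_def)
  interpret D: cdf_distribution \<nu>
    unfolding cdf_distribution_def \<nu>_def by (rule P.real_distribution_distr[OF \<psi>])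
  define F where "F = cdf \<nu>"
  define G where "G u = (if u \<in> {0<..<1} then Inf {x. u \<le> F x} else 0)" for u
  \<comment> \<open>Up to a null set the fibre of \<open>\<psi>\<close> over \<open>s\<close>
    contains at most the point \<open>\<xi> s\<close>, so the image measure inherits the absence of
    atoms.\<close>
  have cont: "isCont F s" for s
  proof -
    have "\<psi> -` {s} \<inter> space P \<subseteq> {p \<in> space P. \<xi> (\<psi> p) \<noteq> p} \<union> {\<xi> s}" by auto
    moreover have "AE p in P. p \<noteq> \<xi> s"
      using measurable_space[OF \<xi>, of s] by (intro AE_I'[OF atomless[of "\<xi> s"]]) auto
    then have "AE p in P. \<psi> p \<noteq> s"
      using inv by eventually_elim auto
    then have "emeasure P (\<psi> -` {s} \<inter> space P) = 0"
      using \<psi> by (subst AE_iff_measurable[symmetric, where P="\<lambda>p. \<psi> p \<noteq> s"]) auto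
    then have "measure \<nu> {s} = 0"
      unfolding \<nu>_def by (subst measure_distr[OF \<psi>]) (simp_all add: measure_def)
    then show ?thesis by (simp add: F_def D.isCont_cdf)
  qed
  \<comment> \<open>\<open>G u\<close> is the least point where \<open>F\<close> reaches the level
    \<open>u\<close>; to its left \<open>F\<close> stays at most \<open>u\<close>, and continuity
    excludes a jump over \<open>u\<close>.\<close>
  have FG: "F (G u) = u" if "0 < u" "u < 1" for u
  proof (rule antisym)
    have I: "u \<le> F x \<longleftrightarrow> G u \<le> x" for x
      using D.pseudoinverse[of u x] that by (simp add: F_def G_def)
    then show "u \<le> F (G u)" by simp
    show "F (G u) \<le> u"
    proof (rule tendsto_upperbound)
      show "(F \<longlongrightarrow> F (G u)) (at_left (G u))"
        using cont[of "G u"] by (simp add: isCont_def filterlim_at_split)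
      show "\<forall>\<^sub>F x in at_left (G u). F x \<le> u"
        using I by (intro eventually_at_leftI[of "G u - 1"]) (auto, meson leI less_imp_le not_le)
    qed simp
  qed
  have FGu: "AE u in uniform_real. F (G u) = u"
    using AE_uniform_real by eventually_elim (simp add: FG)
  have mF [measurable]: "F \<in> borel_measurable borel"
    using D.measurable_C by (simp add: F_def)
  have mG [measurable]: "G \<in> borel_measurable borel"
  proof -
    have "(\<lambda>u. Inf {x. u \<le> F x}) \<in> borel_measurable (restrict_space borel {0<..<1})"
      using D.measurable_CI by (simp add: F_def)
    then show ?thesis
      unfolding G_def by (subst (asm) measurable_restrict_space_iff[where c = 0]) auto
  qed
  have dG: "distr uniform_real borel G = \<nu>"
  proof -
    have "distr uniform_real borel G = distr (restrict_space lborel {0<..<1}) borel G"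
      unfolding uniform_real_def by (subst distr_distr[OF mG measurable_id_uniform_real]) (simp add: comp_def)
    also have "\<dots> = distr (restrict_space lborel {0<..<1}) borel (\<lambda>u. Inf {x. u \<le> F x})"
      by (rule distr_cong) (auto simp: G_def space_restrict_space)
    also have "\<dots> = \<nu>"
      using D.distr_I_eq_M by (simp add: F_def)
    finally show ?thesis .
  qed
  have dF: "distr \<nu> borel F = uniform_real"
  proof -
    have "distr \<nu> borel F = distr uniform_real borel (F \<circ> G)"
      unfolding dG[symmetric] by (rule distr_distr) auto
    also have "\<dots> = distr uniform_real borel (\<lambda>u. u)"
      using FGu by (intro distr_cong_AE) (simp_all add: comp_def)
    also have "\<dots> = uniform_real"
      by (rule measure_eqI) (auto simp: emeasure_distr)
    finally show ?thesis .
  qed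
  have a1: "AE s in \<nu>. \<psi> (\<xi> s) = s"
  proof -
    have [measurable]: "(\<lambda>s. \<psi> (\<xi> s)) \<in> borel_measurable borel"
      using measurable_compose[OF \<xi> \<psi>] .
    have "{s \<in> space borel. \<psi> (\<xi> s) = s} \<in> sets borel" by measurable
    then show ?thesis
      unfolding \<nu>_def by (subst AE_distr_iff[OF \<psi>]) (use inv in \<open>auto elim!: eventually_mono\<close>)
  qed
  \<comment> \<open>\<open>F\<close> may be constant on intervals; the identity still holds almost
    everywhere, because \<open>\<nu>\<close> is the image under \<open>G\<close> and
    \<open>F (G u) = u\<close>.\<close>
  have a2: "AE s in \<nu>. G (F s) = s"
  proof -
    have "{s \<in> space borel. G (F s) = s} \<in> sets borel" by measurable
    then show ?thesis
      unfolding dG[symmetric] using FGu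
      by (subst AE_distr_iff) (auto elim!: eventually_mono)
  qed
  have "AE p in P. G (F (\<psi> p)) = \<psi> p"
    using AE_distrD[OF \<psi> a2[unfolded \<nu>_def]] .
  then have b1: "AE p in P. \<xi> (G (F (\<psi> p))) = p"
    using inv by eventually_elim simp
  have "AE u in uniform_real. \<psi> (\<xi> (G u)) = G u"
    by (rule AE_distrD[OF _ a1[folded dG]]) simp
  then have b2: "AE u in uniform_real. F (\<psi> (\<xi> (G u))) = u"
    using AE_uniform_real by eventually_elim (simp add: FG)
  have c1: "distr P uniform_real (F \<circ> \<psi>) = uniform_real"
  proof -
    have "distr P uniform_real (F \<circ> \<psi>) = distr P borel (F \<circ> \<psi>)" by (rule distr_cong) auto
    also have "\<dots> = distr \<nu> borel F" unfolding \<nu>_def by (rule distr_distr[symmetric, OF mF \<psi>])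
    finally show ?thesis by (simp add: dF)
  qed
  have c2: "distr uniform_real P (\<xi> \<circ> G) = P"
  proof -
    have "distr uniform_real P (\<xi> \<circ> G) = distr \<nu> P \<xi>"
      unfolding dG[symmetric] by (rule distr_distr[symmetric, OF \<xi>]) simp
    also have "\<dots> = distr P P (\<xi> \<circ> \<psi>)"
      unfolding \<nu>_def by (rule distr_distr[OF \<xi> \<psi>])
    also have "\<dots> = distr P P (\<lambda>p. p)"
      using inv measurable_comp[OF \<psi> \<xi>] by (intro distr_cong_AE) auto
    finally show ?thesis by (simp add: distr_id)
  qed
  have m: "F \<circ> \<psi> \<in> measurable P uniform_real" "\<xi> \<circ> G \<in> measurable uniform_real P"
    using measurable_comp[OF \<psi> mF] measurable_comp[OF mG \<xi>]
    by (simp_all cong: measurable_cong_sets)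
  show ?thesis
    unfolding isomorphic_mod_null_def
    by (rule exI[of _ "F \<circ> \<psi>"], rule exI[of _ "\<xi> \<circ> G"]) (use m b1 b2 c1 c2 in auto)
qed

section \<open>Coding bit sequences by reals\<close>

text \<open>The ternary digits are 0 and 2, as in the Cantor set. Unlike a binary expansion this is
  injective without exception, and the gap around 1/2 lets a threshold read off the first
  digit.\<close>

definition cantor :: "(nat \<Rightarrow> bool) \<Rightarrow> real" where
  "cantor x = (\<Sum>i. 2 * of_bool (x i) * (1 / 3) ^ Suc i)"

text \<open>The rescaled tail of the expansion after \<open>n\<close> digits. It is defined at every
  real, so that decoding is a total Borel map.\<close>

primrec cantor_rest :: "nat \<Rightarrow> real \<Rightarrow> real" where
  "cantor_rest 0 s = s"
| "cantor_rest (Suc n) s = 3 * cantor_rest n s - 2 * of_bool (1 / 2 < cantor_rest n s)"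

lemma summable_cantor: "summable (\<lambda>i. 2 * of_bool (x i) * (1 / 3 :: real) ^ Suc i)"
proof (rule summable_comparison_test')
  show "summable (\<lambda>i. 2 * (1 / 3 :: real) ^ Suc i)"
    by (intro summable_mult) (simp add: summable_geometric)
  show "norm (2 * of_bool (x i) * (1 / 3 :: real) ^ Suc i) \<le> 2 * (1 / 3) ^ Suc i" for i
    by (cases "x i") auto
qed

lemma cantor_bounds: "0 \<le> cantor x" "cantor x \<le> 1"
proof -
  show "0 \<le> cantor x"
    unfolding cantor_def by (intro suminf_nonneg summable_cantor) simp
  have "cantor x \<le> (\<Sum>i. 2 * (1 / 3 :: real) ^ Suc i)"
    unfolding cantor_def
  proof (intro suminf_le summable_cantor)
    show "summable (\<lambda>i. 2 * (1 / 3 :: real) ^ Suc i)"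
      by (intro summable_mult) (simp add: summable_geometric)
    show "2 * of_bool (x i) * (1 / 3 :: real) ^ Suc i \<le> 2 * (1 / 3) ^ Suc i" for i
      by (cases "x i") auto
  qed
  also have "\<dots> = 2 / 3 * (\<Sum>i. (1 / 3 :: real) ^ i)"
    by (subst suminf_mult[symmetric]) (auto simp: summable_geometric)
  also have "\<dots> = 1"
    by (subst suminf_geometric) auto
  finally show "cantor x \<le> 1" .
qed

lemma cantor_step: "cantor x = (2 * of_bool (x 0) + cantor (\<lambda>i. x (Suc i))) / 3"
proof -
  have "cantor x = 2 * of_bool (x 0) * (1 / 3) ^ Suc 0 + (\<Sum>i. 2 * of_bool (x (Suc i)) * (1 / 3) ^ Suc (Suc i))"
    unfolding cantor_def by (subst suminf_split_head[OF summable_cantor]) simp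
  also have "(\<Sum>i. 2 * of_bool (x (Suc i)) * (1 / 3 :: real) ^ Suc (Suc i)) =
      (1 / 3) * (\<Sum>i. 2 * of_bool (x (Suc i)) * (1 / 3) ^ Suc i)"
    by (subst suminf_mult[symmetric, OF summable_cantor]) (simp add: mult_ac)
  finally show ?thesis by (simp add: cantor_def)
qed

lemma cantor_rest: "cantor_rest n (cantor x) = cantor (\<lambda>i. x (n + i))"
  and cantor_digit: "1 / 2 < cantor_rest n (cantor x) \<longleftrightarrow> x n"
proof -
  have head: "1 / 2 < cantor y \<longleftrightarrow> y 0" for y
    using cantor_step[of y] cantor_bounds[of "\<lambda>i. y (Suc i)"] by (cases "y 0") auto
  show *: "cantor_rest n (cantor x) = cantor (\<lambda>i. x (n + i))" for n
  proof (induction n)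
    case (Suc n)
    show ?case
      unfolding cantor_rest.simps Suc head using cantor_step[of "\<lambda>i. x (n + i)"] by simp
  qed simp
  show "1 / 2 < cantor_rest n (cantor x) \<longleftrightarrow> x n"
    unfolding * head by simp
qed

lemma measurable_cantor [measurable]: "cantor \<in> borel_measurable coin"
  unfolding cantor_def
  by (intro borel_measurable_suminf borel_measurable_times borel_measurable_const
    measurable_compose[OF measurable_coin_component]) simp

lemma measurable_cantor_rest [measurable]: "cantor_rest n \<in> borel_measurable borel"
  by (induction n) simp_all

definition interleave :: "(nat \<Rightarrow> bool) \<times> (nat \<Rightarrow> bool) \<Rightarrow> nat \<Rightarrow> bool" where
  "interleave p i = (if even i then fst p (i div 2) else snd p (i div 2))"

definition digits :: "real \<Rightarrow> (nat \<Rightarrow> bool) \<times> (nat \<Rightarrow> bool)" where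
  "digits s = (\<lambda>i. 1 / 2 < cantor_rest (2 * i) s, \<lambda>i. 1 / 2 < cantor_rest (Suc (2 * i)) s)"

lemma measurable_interleave [measurable]: "interleave \<in> measurable model coin"
  unfolding interleave_def by (rule measurable_into_coin) measurable

lemma measurable_digits [measurable]: "digits \<in> measurable borel model"
  unfolding digits_def by (intro measurable_Pair measurable_into_coin) measurable

lemma digits_cantor: "digits (cantor (interleave p)) = p"
  unfolding digits_def cantor_digit by (simp add: interleave_def)

text \<open>Any measurable coding by bits that can be undone almost surely will do, whatever law it
  induces on the codes; \<open>cantor\<close> then embeds the codes into the line.\<close>

lemma isomorphic_via_digits:
  assumes "prob_space P" "\<beta> \<in> measurable P model" "\<gamma> \<in> measurable model P"
    "AE p in P. \<gamma> (\<beta> p) = p" "\<And>p. p \<in> space P \<Longrightarrow> {p} \<in> null_sets P"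
  shows "isomorphic_mod_null P uniform_real"
proof (rule isomorphic_uniform_real[where \<psi> = "\<lambda>p. cantor (interleave (\<beta> p))" and \<xi> = "\<lambda>s. \<gamma> (digits s)"])
  show "(\<lambda>p. cantor (interleave (\<beta> p))) \<in> borel_measurable P"
    using assms(2) by measurable
  show "(\<lambda>s. \<gamma> (digits s)) \<in> borel \<rightarrow>\<^sub>M P"
    using assms(3) by measurable
qed (use assms in \<open>simp_all add: digits_cantor\<close>)

lemma isomorphic_model: "isomorphic_mod_null model uniform_real"
proof (rule isomorphic_via_digits)
  show "{p} \<in> null_sets model" for p
  proof -
    have "{fst p} \<in> sets coin" "emeasure coin {fst p} = 0" "{snd p} \<in> sets coin"
      using coin_singleton by (auto simp: null_sets_def)
    then have "{fst p} \<times> {snd p} \<in> null_sets model"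
      by (simp only: null_sets_def mem_Collect_eq coin.emeasure_pair_measure_Times pair_measureI) simp
    then show ?thesis by (simp add: prod_eq_iff Times_insert_left)
  qed
qed (auto intro: model.P.prob_space_axioms)

text \<open>The points of a bounded set are coded by the Dedekind cuts of their coordinates.\<close>

definition clipped_rat :: "nat \<Rightarrow> real" where
  "clipped_rat i = max (- 2) (min 2 (real_of_rat (from_nat i)))"

text \<open>Clipping to \<open>[-2, 2]\<close> and the default \<open>-2\<close> keep the family
  bounded for every bit sequence, as measurability of the supremum requires, and they do not affect
  coordinates in \<open>[-1, 1]\<close>.\<close>

definition sup_below :: "(nat \<Rightarrow> bool) \<Rightarrow> real" where
  "sup_below b = (SUP i. if b i then clipped_rat i else - 2)"

lemma sup_below_less:
  assumes "\<bar>x\<bar> \<le> 1"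
  shows "sup_below (\<lambda>i. clipped_rat i < x) = x"
  unfolding sup_below_def
proof (rule cSup_eq_non_empty)
  show "z \<le> x" if "z \<in> range (\<lambda>i. if clipped_rat i < x then clipped_rat i else - 2)" for z
    using that assms by auto
  fix y assume "\<And>z. z \<in> range (\<lambda>i. if clipped_rat i < x then clipped_rat i else - 2) \<Longrightarrow> z \<le> y"
  then have y: "(if clipped_rat i < x then clipped_rat i else - 2) \<le> y" for i by blast
  show "x \<le> y"
  proof (rule ccontr)
    assume "\<not> x \<le> y"
    then have "max y (- 2) < x" using assms by auto
    then obtain r where r: "max y (- 2) < real_of_rat r" "real_of_rat r < x"
      using of_rat_dense by blast
    have "clipped_rat (to_nat r) = real_of_rat r"
      using r assms by (auto simp: clipped_rat_def)
    then show False using y[of "to_nat r"] r by auto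
  qed
qed blast

lemma measurable_sup_below [measurable]: "sup_below \<in> borel_measurable coin"
  unfolding sup_below_def
proof (rule borel_measurable_cSUP)
  show "bdd_above (range (\<lambda>i. if x i then clipped_rat i else - 2))" for x
    by (rule bdd_aboveI[of _ 2]) (auto simp: clipped_rat_def)
qed auto

lemma isomorphic_uniform_measure_model:
  fixes X :: "(real \<times> real) set"
  assumes X: "X \<in> sets borel" "emeasure lborel X \<noteq> 0" "emeasure lborel X \<noteq> \<infinity>"
    and bounded: "\<And>p. p \<in> X \<Longrightarrow> \<bar>fst p\<bar> \<le> 1 \<and> \<bar>snd p\<bar> \<le> 1"
  shows "isomorphic_mod_null (uniform_measure lborel X) model"
proof (rule isomorphic_mod_null_trans[OF isomorphic_via_digits isomorphic_mod_null_sym[OF isomorphic_model]])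
  show "prob_space (uniform_measure lborel X)"
    using X by (intro prob_space_uniform_measure) auto
  have m: "measurable (uniform_measure lborel X) N = measurable borel N" for N :: "'b measure"
    by (rule measurable_cong_sets) auto
  have [measurable]: "fst \<in> borel_measurable (borel :: (real \<times> real) measure)"
    "snd \<in> borel_measurable (borel :: (real \<times> real) measure)"
    by (simp_all add: borel_prod[symmetric])
  show "(\<lambda>p. (\<lambda>i. clipped_rat i < fst p, \<lambda>i. clipped_rat i < snd p)) \<in> uniform_measure lborel X \<rightarrow>\<^sub>M model"
    by (intro measurable_Pair measurable_into_coin; unfold m) measurable
  show "(\<lambda>q. (sup_below (fst q), sup_below (snd q))) \<in> model \<rightarrow>\<^sub>M uniform_measure lborel X"
    by (simp add: borel_prod[symmetric])
  have "AE p in uniform_measure lborel X. p \<in> X"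
    using X by (intro AE_uniform_measureI) auto
  then show "AE p in uniform_measure lborel X.
      (sup_below (fst (\<lambda>i. clipped_rat i < fst p, \<lambda>i. clipped_rat i < snd p)),
       sup_below (snd (\<lambda>i. clipped_rat i < fst p, \<lambda>i. clipped_rat i < snd p))) = p"
    by eventually_elim (use bounded in \<open>auto simp: sup_below_less\<close>)
  show "{p} \<in> null_sets (uniform_measure lborel X)" for p
  proof -
    have "emeasure lborel (X \<inter> {p}) \<le> emeasure lborel {p}" by (rule emeasure_mono) auto
    then show ?thesis using X by (simp add: null_sets_def)
  qed
qed

section \<open>Ergodicity, rigidity and slow entropy of realizations\<close>

text \<open>A realization of the skew product through a factor map \<open>\<Phi>\<close>. The last
  assumption says that \<open>\<Phi>\<close> loses nothing modulo null sets; it speaks of sets,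
  because \<open>M\<close> will contain all Lebesgue measurable subsets of \<open>X\<close> while
  \<open>model\<close> carries only the product sigma algebra.\<close>

locale skew_extension = prob_space M
  for M :: "'a measure" +
  fixes T :: "'a \<Rightarrow> 'a" and \<Phi> :: "'a \<Rightarrow> (nat \<Rightarrow> bool) \<times> (nat \<Rightarrow> bool)" and E :: "nat set"
  assumes measurable_T [measurable]: "T \<in> measurable M M"
    and distr_T: "distr M M T = M"
    and measurable_\<Phi> [measurable]: "\<Phi> \<in> measurable M model"
    and distr_\<Phi>: "distr M model \<Phi> = model"
    and equivariant: "AE p in M. \<Phi> (T p) = skew E (\<Phi> p)"
    and sets_from_model: "\<And>A. A \<in> sets M \<Longrightarrow> \<exists>B\<in>sets model. AE p in M. p \<in> A \<longleftrightarrow> \<Phi> p \<in> B"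
begin

lemma measurable_T_funpow [measurable]: "T ^^ k \<in> measurable M M"
  by (rule measurable_compose_n) simp

lemma distr_T_funpow: "distr M M (T ^^ k) = M"
  by (rule distr_funpow[OF measurable_T distr_T])

lemma measure_vimage_T: "A \<in> sets M \<Longrightarrow> measure M ((T ^^ k) -` A \<inter> space M) = measure M A"
  using measure_distr[OF measurable_T_funpow, of A k] by (simp add: distr_T_funpow)

lemma measure_vimage_\<Phi>: "B \<in> sets model \<Longrightarrow> measure M (\<Phi> -` B \<inter> space M) = measure model B"
  using measure_distr[OF measurable_\<Phi>, of B] by (simp add: distr_\<Phi>)

lemma sets_vimage_\<Phi>: "B \<in> sets model \<Longrightarrow> \<Phi> -` B \<inter> space M \<in> sets M"
  by (rule measurable_sets[OF measurable_\<Phi>])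

lemma sets_vimage_T: "A \<in> sets M \<Longrightarrow> (T ^^ k) -` A \<inter> space M \<in> sets M"
  by (rule measurable_sets[OF measurable_T_funpow])

lemma T_funpow_space: "p \<in> space M \<Longrightarrow> (T ^^ k) p \<in> space M"
  using measurable_space[OF measurable_T_funpow] .

lemma equivariant_funpow: "AE p in M. \<forall>k. \<Phi> ((T ^^ k) p) = (skew E ^^ k) (\<Phi> p)"
proof -
  have "AE p in M. \<Phi> (T ((T ^^ k) p)) = skew E (\<Phi> ((T ^^ k) p))" for k
    using AE_distrD[OF measurable_T_funpow, unfolded distr_T_funpow, OF equivariant] .
  then have "AE p in M. \<forall>k. \<Phi> (T ((T ^^ k) p)) = skew E (\<Phi> ((T ^^ k) p))"
    by (simp add: AE_all_countable)
  then show ?thesis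
  proof eventually_elim
    case (elim p)
    show ?case
    proof
      fix k show "\<Phi> ((T ^^ k) p) = (skew E ^^ k) (\<Phi> p)"
        by (induction k) (use elim in auto)
    qed
  qed
qed

lemma approximation:
  assumes A: "A \<in> sets M" and "0 < \<epsilon>"
  shows "\<exists>J C. depends J C \<and> measure M (sym_diff A (\<Phi> -` C \<inter> space M)) < \<epsilon>"
proof -
  obtain B where B: "B \<in> sets model" "AE p in M. p \<in> A \<longleftrightarrow> \<Phi> p \<in> B"
    using sets_from_model[OF A] by blast
  obtain J C where C: "depends J C" "measure model (sym_diff B C) < \<epsilon>"
    using model_approximation[OF B(1) assms(2)] by blast
  have C': "C \<in> sets model" by (rule sets_depends[OF C(1)])
  have "measure M (sym_diff A (\<Phi> -` C \<inter> space M)) = measure M (\<Phi> -` sym_diff B C \<inter> space M)"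
  proof (rule finite_measure_eq_AE)
    show "AE p in M. p \<in> sym_diff A (\<Phi> -` C \<inter> space M) \<longleftrightarrow> p \<in> \<Phi> -` sym_diff B C \<inter> space M"
      using B(2) AE_space by eventually_elim auto
    show "sym_diff A (\<Phi> -` C \<inter> space M) \<in> sets M"
      using A sets_vimage_\<Phi>[OF C'] by auto
    show "\<Phi> -` sym_diff B C \<inter> space M \<in> sets M"
      using B(1) C' by (intro sets_vimage_\<Phi>) auto
  qed
  also have "\<dots> = measure model (sym_diff B C)"
    using B(1) C' by (intro measure_vimage_\<Phi>) auto
  finally show ?thesis using C by (intro exI[of _ J] exI[of _ C]) simp
qed

text \<open>The number of bits below \<open>m\<close> that lie outside \<open>E\<close> is
  \<open>m - card (E \<inter> {..<m})\<close>, which exceeds any given \<open>L\<close> once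
  \<open>m\<close> is large.\<close>

lemma small_window:
  fixes \<epsilon> :: real
  assumes "infinite (- E)" "0 < \<epsilon>"
  shows "\<exists>m\<ge>J. 2 ^ J * 2 ^ card (E \<inter> {..<m}) \<le> \<epsilon> * 2 ^ m"
proof -
  have "(\<lambda>L. 2 ^ J * (1 / 2 :: real) ^ L) \<longlonglongrightarrow> 2 ^ J * 0"
    by (intro tendsto_mult tendsto_const LIMSEQ_realpow_zero) auto
  then have "\<forall>\<^sub>F L in sequentially. 2 ^ J * (1 / 2 :: real) ^ L < \<epsilon>"
    using assms(2) by (intro order_tendstoD(2)) auto
  then obtain L where L: "2 ^ J * (1 / 2 :: real) ^ L < \<epsilon>"
    by (auto simp: eventually_sequentially)
  obtain S where S: "finite S" "card S = L" "S \<subseteq> - E"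
    using infinite_arbitrarily_large[OF assms(1)] by blast
  obtain b where b: "S \<subseteq> {..<b}"
    using finite_nat_bounded[OF S(1)] by blast
  define m where "m = max J b"
  have "card (E \<inter> {..<m}) + card S = card (E \<inter> {..<m} \<union> S)"
    using S by (intro card_Un_disjoint[symmetric]) auto
  also have "\<dots> \<le> card {..<m}"
    using b by (intro card_mono) (auto simp: m_def)
  finally have c: "card (E \<inter> {..<m}) + L \<le> m" using S by simp
  have "2 ^ J * 2 ^ card (E \<inter> {..<m}) = (2 ^ J * (1 / 2) ^ L) * (2 ^ (card (E \<inter> {..<m}) + L) :: real)"
    by (simp add: power_add power_divide)
  also have "\<dots> \<le> \<epsilon> * 2 ^ m"
    using L c assms(2) by (intro mult_mono power_increasing) auto
  finally show ?thesis by (intro exI[of _ m]) (auto simp: m_def)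
qed

text \<open>An invariant \<open>A\<close> has constant correlation \<open>a\<close> with its
  preimages, while for a nearby event in a finite window the correlation is on average hardly more
  than the square of its measure. Hence \<open>a \<le> a\<^sup>2\<close>, which forces
  \<open>a\<close> to be 0 or 1.\<close>

lemma ergodic_T:
  assumes "infinite (- E)"
  shows "ergodic M T"
  unfolding ergodic_def
proof (intro ballI impI)
  fix A assume A: "A \<in> sets M" and inv: "T -` A \<inter> space M = A"
  define a where "a = measure M A"
  have inv_k: "(T ^^ k) -` A \<inter> space M = A" for k
  proof (induction k)
    case (Suc k)
    have "(T ^^ Suc k) -` A \<inter> space M = (T ^^ k) -` (T -` A \<inter> space M) \<inter> space M"
      using T_funpow_space by auto
    then show ?case unfolding inv Suc .
  qed (use sets.sets_into_space[OF A] in auto)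
  have a01: "0 \<le> a" "a \<le> 1" by (auto simp: a_def)
  \<comment> \<open>Of the five errors two come from replacing \<open>A\<close> by \<open>D\<close>
    at times 0 and \<open>k\<close>, one from the window estimate, and two from comparing
    \<open>c\<^sup>2\<close> with \<open>a\<^sup>2\<close>.\<close>
  have "a \<le> a\<^sup>2 + 5 * \<epsilon>" if eps: "0 < \<epsilon>" for \<epsilon>
  proof -
    obtain J C where C: "depends J C" and AC: "measure M (sym_diff A (\<Phi> -` C \<inter> space M)) < \<epsilon>"
      using approximation[OF A eps] by blast
    define D where "D = \<Phi> -` C \<inter> space M"
    have C': "C \<in> sets model" by (rule sets_depends[OF C])
    have D: "D \<in> sets M" unfolding D_def by (rule sets_vimage_\<Phi>[OF C'])
    have AD: "measure M (sym_diff A D) < \<epsilon>" using AC by (simp add: D_def)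
    have sAD: "sym_diff A D \<in> sets M" using A D by auto
    define c where "c = measure model C"
    have c: "c = measure M D" by (simp add: c_def D_def measure_vimage_\<Phi>[OF C'])
    have ca: "c \<le> a + \<epsilon>"
    proof -
      have "measure M D \<le> measure M (A \<union> sym_diff A D)"
        using A D by (intro finite_measure_mono) auto
      also have "\<dots> \<le> measure M A + measure M (sym_diff A D)"
        using A sAD by (rule measure_Un_le)
      finally show ?thesis using AD by (simp add: a_def c)
    qed
    have corr: "a \<le> measure model (C \<inter> (skew E ^^ k) -` C) + 2 * \<epsilon>" for k
    proof -
      let ?DD = "D \<inter> ((T ^^ k) -` D \<inter> space M)"
      let ?R = "(T ^^ k) -` sym_diff A D \<inter> space M"
      have s: "?DD \<in> sets M" "?R \<in> sets M"
        using D sets_vimage_T[OF D] sets_vimage_T[OF sAD] by blast+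
      have "A \<subseteq> (?DD \<union> sym_diff A D) \<union> ?R"
      proof
        fix p assume p: "p \<in> A"
        then have "p \<in> (T ^^ k) -` A \<inter> space M" by (simp add: inv_k)
        then show "p \<in> (?DD \<union> sym_diff A D) \<union> ?R" using p by auto
      qed
      then have "a \<le> measure M ((?DD \<union> sym_diff A D) \<union> ?R)"
        unfolding a_def using s sAD by (intro finite_measure_mono) auto
      also have "\<dots> \<le> (measure M ?DD + measure M (sym_diff A D)) + measure M ?R"
        using s sAD by (intro order_trans[OF measure_Un_le] add_right_mono measure_Un_le) auto
      also have "measure M ?R = measure M (sym_diff A D)"
        by (rule measure_vimage_T[OF sAD])
      also have "measure M ?DD = measure M (\<Phi> -` (C \<inter> (skew E ^^ k) -` C) \<inter> space M)"
      proof (rule finite_measure_eq_AE)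
        show "AE p in M. p \<in> ?DD \<longleftrightarrow> p \<in> \<Phi> -` (C \<inter> (skew E ^^ k) -` C) \<inter> space M"
          using equivariant_funpow AE_space
          by eventually_elim (auto simp: D_def T_funpow_space)
        show "\<Phi> -` (C \<inter> (skew E ^^ k) -` C) \<inter> space M \<in> sets M"
          by (intro sets_vimage_\<Phi> sets.Int C' vimage_skew_funpow)
      qed (rule s)
      also have "\<dots> = measure model (C \<inter> (skew E ^^ k) -` C)"
        by (intro measure_vimage_\<Phi> sets.Int C' vimage_skew_funpow)
      finally show ?thesis using AD by simp
    qed
    obtain m where m: "J \<le> m" "2 ^ J * 2 ^ card (E \<inter> {..<m}) \<le> \<epsilon> * 2 ^ m"
      using small_window[OF assms eps] by blast
    have "2 ^ m * a = (\<Sum>k<(2::nat) ^ m. a)" by simp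
    also have "\<dots> \<le> (\<Sum>k<(2::nat) ^ m. measure model (C \<inter> (skew E ^^ k) -` C) + 2 * \<epsilon>)"
      by (intro sum_mono corr)
    also have "\<dots> = (\<Sum>k<(2::nat) ^ m. measure model (C \<inter> (skew E ^^ k) -` C)) + 2 ^ m * (2 * \<epsilon>)"
      by (simp add: sum.distrib)
    also have "\<dots> \<le> 2 ^ m * c\<^sup>2 + \<epsilon> * 2 ^ m + 2 ^ m * (2 * \<epsilon>)"
      using skew_average[OF C m(1), of E] m(2) by (simp add: c_def)
    also have "\<dots> = 2 ^ m * (c\<^sup>2 + 3 * \<epsilon>)" by (simp add: algebra_simps)
    finally have "a \<le> c\<^sup>2 + 3 * \<epsilon>" by simp
    moreover have "c\<^sup>2 \<le> a\<^sup>2 + 2 * \<epsilon>"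
    proof (cases "c \<le> a")
      case True
      have "c\<^sup>2 \<le> a\<^sup>2" using True by (intro power_mono) (auto simp: c)
      then show ?thesis using eps by simp
    next
      case False
      have "c\<^sup>2 - a\<^sup>2 = (c - a) * (c + a)" by (simp add: power2_eq_square algebra_simps)
      also have "\<dots> \<le> \<epsilon> * 2"
      proof (rule mult_mono)
        have "c \<le> 1" by (simp add: c)
        then show "c + a \<le> 2" using a01 by simp
        show "0 \<le> c + a" using a01 False by simp
      qed (use ca eps in auto)
      finally show ?thesis by simp
    qed
    ultimately show ?thesis by simp
  qed
  from this[of "\<epsilon> / 5" for \<epsilon>] have "a \<le> a\<^sup>2 + \<epsilon>" if "0 < \<epsilon>" for \<epsilon>
    using that by simp
  then have "a \<le> a\<^sup>2" by (rule field_le_epsilon)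
  then have "a * (1 - a) \<le> 0" by (simp add: power2_eq_square algebra_simps)
  then have "a = 0 \<or> a = 1"
    using a01 by (auto simp: mult_le_0_iff)
  then show "emeasure M A = 0 \<or> emeasure M (space M - A) = 0"
    using A by (auto simp: a_def emeasure_eq_measure prob_compl)
qed

end

section \<open>L2 convergence along the rigidity times\<close>

lemma norm_add3_squared_le:
  fixes a b c :: "'b::real_normed_vector"
  shows "(norm (a + b + c))\<^sup>2 \<le> 3 * ((norm a)\<^sup>2 + (norm b)\<^sup>2 + (norm c)\<^sup>2)"
proof -
  have "norm (a + b + c) \<le> norm a + norm b + norm c"
    by (metis norm_triangle_ineq add_right_mono order_trans)
  then have "(norm (a + b + c))\<^sup>2 \<le> (norm a + norm b + norm c)\<^sup>2"
    by (intro power_mono) auto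
  also have "\<dots> \<le> 3 * ((norm a)\<^sup>2 + (norm b)\<^sup>2 + (norm c)\<^sup>2)"
    using zero_le_power2[of "norm a - norm b"] zero_le_power2[of "norm b - norm c"]
      zero_le_power2[of "norm a - norm c"]
    by (simp add: power2_eq_square algebra_simps)
  finally show ?thesis .
qed

text \<open>The approximants satisfy \<open>norm (s i x) \<le> 2 * norm (f x)\<close>, so dominated
  convergence applies with the bound \<open>9 * (norm (f x))\<^sup>2\<close>.\<close>

lemma simple_L2_approximation:
  assumes "square_integrable M f" "0 < \<epsilon>"
  shows "\<exists>s. simple_function M s \<and> integrable M (\<lambda>x. (norm (f x - s x))\<^sup>2) \<and>
    (\<integral>x. (norm (f x - s x))\<^sup>2 \<partial>M) < \<epsilon>"
proof -
  have [measurable]: "f \<in> borel_measurable M" and int: "integrable M (\<lambda>x. (norm (f x))\<^sup>2)"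
    using assms(1) by (auto simp: square_integrable_def)
  obtain s where "\<forall>i. simple_function M (s i)" "\<forall>x\<in>space M. (\<lambda>i. s i x) \<longlonglongrightarrow> f x"
    "\<forall>i. \<forall>x\<in>space M. dist (s i x) 0 \<le> 2 * dist (f x) 0"
    using borel_measurable_implies_sequence_metric[of f M 0] by auto
  then have s: "\<And>i. simple_function M (s i)"
    and lim: "\<And>x. x \<in> space M \<Longrightarrow> (\<lambda>i. s i x) \<longlonglongrightarrow> f x"
    and bound: "\<And>i x. x \<in> space M \<Longrightarrow> norm (s i x) \<le> 2 * norm (f x)"
    by auto
  have [measurable]: "s i \<in> borel_measurable M" for i
    using s by (rule borel_measurable_simple_function)
  have dom: "norm ((norm (f x - s i x))\<^sup>2) \<le> 9 * (norm (f x))\<^sup>2" if "x \<in> space M" for i x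
  proof -
    have "norm (f x - s i x) \<le> 3 * norm (f x)"
      using norm_triangle_ineq4[of "f x" "s i x"] bound[OF that, of i] by simp
    then have "(norm (f x - s i x))\<^sup>2 \<le> (3 * norm (f x))\<^sup>2" by (intro power_mono) auto
    then show ?thesis by (simp add: power_mult_distrib)
  qed
  have lim0: "(\<lambda>i. (norm (f x - s i x))\<^sup>2) \<longlonglongrightarrow> 0" if "x \<in> space M" for x
  proof -
    have "(\<lambda>i. (norm (f x - s i x))\<^sup>2) \<longlonglongrightarrow> (norm (f x - f x))\<^sup>2"
      by (intro tendsto_intros lim that)
    then show ?thesis by simp
  qed
  have "(\<lambda>i. \<integral>x. (norm (f x - s i x))\<^sup>2 \<partial>M) \<longlonglongrightarrow> (\<integral>x. 0 \<partial>M)"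
    by (rule integral_dominated_convergence[where w="\<lambda>x. 9 * (norm (f x))\<^sup>2"])
      (use int dom lim0 in \<open>auto intro!: AE_I2\<close>)
  then have "\<forall>\<^sub>F i in sequentially. (\<integral>x. (norm (f x - s i x))\<^sup>2 \<partial>M) < \<epsilon>"
    using assms(2) by (intro order_tendstoD(2)) auto
  then obtain i where "(\<integral>x. (norm (f x - s i x))\<^sup>2 \<partial>M) < \<epsilon>"
    by (auto simp: eventually_sequentially)
  moreover have "integrable M (\<lambda>x. (norm (f x - s i x))\<^sup>2)"
    by (rule Bochner_Integration.integrable_bound[of M "\<lambda>x. 9 * (norm (f x))\<^sup>2"])
      (use int dom in \<open>auto intro!: AE_I2\<close>)
  ultimately show ?thesis using s by blast
qed

context skew_extension
begin

text \<open>With \<open>A\<close> replaced by a set \<open>D\<close> that comes from a finite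
  window, the error is spent in thirds: at time 0, at time \<open>2 ^ e n\<close>, and on the rare
  block of ones. As \<open>n \<le> e n\<close>, every window eventually lies below the
  block.\<close>

lemma almost_invariant:
  assumes e: "strict_mono e" "\<And>n. {e n..<e n + n} \<subseteq> E" and A: "A \<in> sets M"
  shows "(\<lambda>n. measure M {p \<in> space M. ((T ^^ (2 ^ e n)) p \<in> A) \<noteq> (p \<in> A)}) \<longlonglongrightarrow> 0"
proof (rule LIMSEQ_I)
  fix r :: real assume "0 < r"
  then have r: "0 < r / 3" by simp
  obtain J C where C: "depends J C" and AC: "measure M (sym_diff A (\<Phi> -` C \<inter> space M)) < r / 3"
    using approximation[OF A r] by blast
  define D where "D = \<Phi> -` C \<inter> space M"
  have C': "C \<in> sets model" by (rule sets_depends[OF C])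
  have D: "D \<in> sets M" unfolding D_def by (rule sets_vimage_\<Phi>[OF C'])
  have AD: "measure M (sym_diff A D) < r / 3" using AC by (simp add: D_def)
  have sAD: "sym_diff A D \<in> sets M" using A D by auto
  have "\<forall>\<^sub>F n in sequentially. (1 / 2 :: real) ^ n < r / 3"
    using r by (intro order_tendstoD(2)[OF LIMSEQ_realpow_zero]) auto
  then obtain N where N: "\<And>n. N \<le> n \<Longrightarrow> (1 / 2 :: real) ^ n < r / 3"
    by (auto simp: eventually_sequentially)
  have "measure M {p \<in> space M. ((T ^^ (2 ^ e n)) p \<in> A) \<noteq> (p \<in> A)} < r" if n: "max J N \<le> n" for n
  proof -
    define k :: nat where "k = 2 ^ e n"
    let ?R = "(T ^^ k) -` sym_diff A D \<inter> space M"
    let ?B = "{y. ((skew E ^^ k) y \<in> C) \<noteq> (y \<in> C)}"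
    have "?B = sym_diff ((skew E ^^ k) -` C) C" by auto
    then have B: "?B \<in> sets model" using vimage_skew_funpow[OF C', of k E] C' by (simp only:) blast
    let ?S = "{p \<in> space M. ((T ^^ k) p \<in> D) \<noteq> (p \<in> D)}"
    have "?S = sym_diff ((T ^^ k) -` D \<inter> space M) D" using sets.sets_into_space[OF D] by auto
    then have S: "?S \<in> sets M" using sets_vimage_T[OF D, of k] D by (simp only:) blast
    have R: "?R \<in> sets M" by (rule sets_vimage_T[OF sAD])
    have "measure M {p \<in> space M. ((T ^^ k) p \<in> A) \<noteq> (p \<in> A)} \<le> measure M ((?S \<union> sym_diff A D) \<union> ?R)"
      using R S A D by (intro finite_measure_mono sets.Un sets.Diff) auto
    also have "\<dots> \<le> (measure M ?S + measure M (sym_diff A D)) + measure M ?R"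
      using R S A D
      by (intro order_trans[OF measure_Un_le] add_right_mono measure_Un_le sets.Un sets.Diff) auto
    also have "measure M ?R = measure M (sym_diff A D)"
      by (rule measure_vimage_T[OF sAD])
    also have "measure M ?S = measure M (\<Phi> -` ?B \<inter> space M)"
    proof (rule finite_measure_eq_AE)
      show "AE p in M. p \<in> ?S \<longleftrightarrow> p \<in> \<Phi> -` ?B \<inter> space M"
        using equivariant_funpow AE_space
        by eventually_elim (auto simp: D_def T_funpow_space)
    qed (use S B sets_vimage_\<Phi> in blast)+
    also have "\<dots> = measure model ?B" by (rule measure_vimage_\<Phi>[OF B])
    also have "\<dots> \<le> (1 / 2) ^ n"
      unfolding k_def
    proof (rule skew_almost_fixed[OF C _ e(2)])
      show "J \<le> e n" using strict_mono_imp_increasing[OF e(1), of n] n by simp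
    qed
    finally show ?thesis using AD N[of n] n by (simp add: k_def)
  qed
  then show "\<exists>N. \<forall>n\<ge>N. norm (measure M {p \<in> space M. ((T ^^ (2 ^ e n)) p \<in> A) \<noteq> (p \<in> A)} - 0) < r"
    by (intro exI[of _ "max J N"]) auto
qed

lemma simple_almost_invariant:
  fixes s :: "'a \<Rightarrow> complex"
  assumes e: "strict_mono e" "\<And>n. {e n..<e n + n} \<subseteq> E" and s: "simple_function M s"
  shows "(\<lambda>n. \<integral>x. (norm (s ((T ^^ (2 ^ e n)) x) - s x))\<^sup>2 \<partial>M) \<longlonglongrightarrow> 0"
proof -
  define V where "V = s ` space M"
  define b where "b = (\<Sum>v\<in>V. norm v)"
  define A where "A v = s -` {v} \<inter> space M" for v
  define Q where "Q n v = {p \<in> space M. ((T ^^ (2 ^ e n)) p \<in> A v) \<noteq> (p \<in> A v)}" for n v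
  have V: "finite V" using s by (simp add: V_def simple_function_def)
  have [measurable]: "s \<in> borel_measurable M" using s by (rule borel_measurable_simple_function)
  have A: "A v \<in> sets M" for v unfolding A_def by measurable
  have Q: "Q n v \<in> sets M" for n v
  proof -
    have "Q n v = sym_diff ((T ^^ (2 ^ e n)) -` A v \<inter> space M) (A v)"
      using sets.sets_into_space[OF A] by (auto simp: Q_def)
    then show ?thesis using sets_vimage_T[OF A] A by (simp only:) blast
  qed
  have nb: "norm (s x) \<le> b" if "x \<in> space M" for x
    unfolding b_def using that V by (intro member_le_sum) (auto simp: V_def)
  have pt: "(norm (s ((T ^^ (2 ^ e n)) x) - s x))\<^sup>2 \<le> (2 * b)\<^sup>2" if "x \<in> space M" for n x
  proof -
    have "norm (s ((T ^^ (2 ^ e n)) x) - s x) \<le> 2 * b"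
      using norm_triangle_ineq4[of "s ((T ^^ (2 ^ e n)) x)" "s x"] nb[OF that]
        nb[OF T_funpow_space[OF that, of "2 ^ e n"]] by simp
    then show ?thesis by (intro power_mono) auto
  qed
  have le: "(\<integral>x. (norm (s ((T ^^ (2 ^ e n)) x) - s x))\<^sup>2 \<partial>M) \<le> (2 * b)\<^sup>2 * (\<Sum>v\<in>V. measure M (Q n v))" for n
  proof -
    have "(\<integral>x. (norm (s ((T ^^ (2 ^ e n)) x) - s x))\<^sup>2 \<partial>M) \<le>
      (\<integral>x. (2 * b)\<^sup>2 * (\<Sum>v\<in>V. indicator (Q n v) x) \<partial>M)"
    proof (rule integral_mono)
      show "integrable M (\<lambda>x. (norm (s ((T ^^ (2 ^ e n)) x) - s x))\<^sup>2)"
        by (rule integrable_const_bound[of _ "(2 * b)\<^sup>2"]) (use pt in \<open>auto intro!: AE_I2\<close>)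
      show "integrable M (\<lambda>x. (2 * b)\<^sup>2 * (\<Sum>v\<in>V. indicator (Q n v) x))"
        by (intro integrable_mult_right Bochner_Integration.integrable_sum integrable_real_indicator Q)
          (simp add: emeasure_eq_measure)
      fix x assume x: "x \<in> space M"
      show "(norm (s ((T ^^ (2 ^ e n)) x) - s x))\<^sup>2 \<le> (2 * b)\<^sup>2 * (\<Sum>v\<in>V. indicator (Q n v) x)"
      proof (cases "s ((T ^^ (2 ^ e n)) x) = s x")
        case False
        \<comment> \<open>A point where \<open>s\<close> changes value leaves the level set of its
          old value.\<close>
        then have "x \<in> Q n (s x)" using x by (simp add: Q_def A_def)
        moreover have "s x \<in> V" using x by (simp add: V_def)
        ultimately have "1 \<le> (\<Sum>v\<in>V. indicator (Q n v) x :: real)"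
          using V member_le_sum[of "s x" V "\<lambda>v. indicator (Q n v) x :: real"] by simp
        then have "(2 * b)\<^sup>2 * 1 \<le> (2 * b)\<^sup>2 * (\<Sum>v\<in>V. indicator (Q n v) x)"
          by (intro mult_left_mono) auto
        then show ?thesis using pt[OF x, of n] by simp
      qed (simp add: sum_nonneg)
    qed
    also have "\<dots> = (2 * b)\<^sup>2 * (\<Sum>v\<in>V. measure M (Q n v))"
    proof -
      have "integrable M (indicator (Q n v) :: 'a \<Rightarrow> real)" for v
        by (rule integrable_real_indicator[OF Q]) (simp add: emeasure_eq_measure)
      then show ?thesis
        using Q by (simp add: Bochner_Integration.integral_sum)
    qed
    finally show ?thesis .
  qed
  have "(\<lambda>n. (2 * b)\<^sup>2 * (\<Sum>v\<in>V. measure M (Q n v))) \<longlonglongrightarrow> (2 * b)\<^sup>2 * (\<Sum>v\<in>V. 0)"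
    unfolding Q_def by (intro tendsto_mult tendsto_const tendsto_sum almost_invariant e A)
  then have upper: "(\<lambda>n. (2 * b)\<^sup>2 * (\<Sum>v\<in>V. measure M (Q n v))) \<longlonglongrightarrow> 0" by simp
  show ?thesis
  proof (rule tendsto_sandwich[OF _ _ tendsto_const upper])
    show "\<forall>\<^sub>F n in sequentially. 0 \<le> (\<integral>x. (norm (s ((T ^^ (2 ^ e n)) x) - s x))\<^sup>2 \<partial>M)"
      by simp
    show "\<forall>\<^sub>F n in sequentially. (\<integral>x. (norm (s ((T ^^ (2 ^ e n)) x) - s x))\<^sup>2 \<partial>M) \<le>
        (2 * b)\<^sup>2 * (\<Sum>v\<in>V. measure M (Q n v))"
      by (intro always_eventually allI le)
  qed
qed

lemma rigid_T:
  assumes e: "strict_mono e" "\<And>n. {e n..<e n + n} \<subseteq> E"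
  shows "rigid M T"
  unfolding rigid_def
proof (intro exI[of _ "\<lambda>n. 2 ^ e n"] conjI allI impI)
  show "strict_mono (\<lambda>n. (2::nat) ^ e n)"
    using e(1) by (auto simp: strict_mono_def)
  fix f :: "'a \<Rightarrow> complex" assume f: "square_integrable M f"
  then have [measurable]: "f \<in> borel_measurable M" by (simp add: square_integrable_def)
  have "(\<lambda>n. \<integral>x. (norm (f ((T ^^ (2 ^ e n)) x) - f x))\<^sup>2 \<partial>M) \<longlonglongrightarrow> 0"
  proof (rule LIMSEQ_I)
    fix r :: real assume "0 < r"
    \<comment> \<open>The budget is \<open>3 * (r / 12 + r / 6 + r / 12) = r\<close>. The factor 3
      comes from \<open>norm_add3_squared_le\<close>; the approximation error occurs at
      \<open>x\<close> and at \<open>S x\<close>, with equal integrals since \<open>S\<close>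
      preserves \<open>M\<close>.\<close>
    then have "0 < r / 12" by simp
    from simple_L2_approximation[OF f this] obtain s
      where s: "simple_function M s" and int: "integrable M (\<lambda>x. (norm (f x - s x))\<^sup>2)"
        and small: "(\<integral>x. (norm (f x - s x))\<^sup>2 \<partial>M) < r / 12" by blast
    have [measurable]: "s \<in> borel_measurable M" using s by (rule borel_measurable_simple_function)
    have "\<forall>\<^sub>F n in sequentially. (\<integral>x. (norm (s ((T ^^ (2 ^ e n)) x) - s x))\<^sup>2 \<partial>M) < r / 6"
      using \<open>0 < r\<close> by (intro order_tendstoD(2)[OF simple_almost_invariant[OF e s]]) auto
    then obtain N where N: "\<And>n. N \<le> n \<Longrightarrow> (\<integral>x. (norm (s ((T ^^ (2 ^ e n)) x) - s x))\<^sup>2 \<partial>M) < r / 6"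
      by (auto simp: eventually_sequentially)
    have "(\<integral>x. (norm (f ((T ^^ (2 ^ e n)) x) - f x))\<^sup>2 \<partial>M) < r" if "N \<le> n" for n
    proof -
      define S where "S = T ^^ (2 ^ e n)"
      have S [measurable]: "S \<in> measurable M M" by (simp add: S_def)
      have dS: "distr M M S = M" by (simp add: S_def distr_T_funpow)
      have intS: "integrable M (\<lambda>x. (norm (f (S x) - s (S x)))\<^sup>2)"
        by (rule integrable_distr[OF S]) (simp add: dS int)
      have eqS: "(\<integral>x. (norm (f (S x) - s (S x)))\<^sup>2 \<partial>M) = (\<integral>x. (norm (f x - s x))\<^sup>2 \<partial>M)"
        using integral_distr[OF S, of "\<lambda>x. (norm (f x - s x))\<^sup>2"] by (simp add: dS)
      obtain b where b: "\<And>x. x \<in> space M \<Longrightarrow> norm (s x) \<le> b"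
      proof
        fix x assume "x \<in> space M"
        then show "norm (s x) \<le> (\<Sum>v\<in>s ` space M. norm v)"
          using s by (intro member_le_sum) (auto simp: simple_function_def)
      qed
      have ints: "integrable M (\<lambda>x. (norm (s (S x) - s x))\<^sup>2)"
      proof (rule integrable_const_bound[of _ "(2 * b)\<^sup>2"])
        show "AE x in M. norm ((norm (s (S x) - s x))\<^sup>2) \<le> (2 * b)\<^sup>2"
        proof (rule AE_I2)
          fix x assume x: "x \<in> space M"
          have "norm (s (S x) - s x) \<le> 2 * b"
            using norm_triangle_ineq4[of "s (S x)" "s x"] b[OF x] b[OF measurable_space[OF S x]] by simp
          then have "(norm (s (S x) - s x))\<^sup>2 \<le> (2 * b)\<^sup>2" by (rule power_mono) simp
          then show "norm ((norm (s (S x) - s x))\<^sup>2) \<le> (2 * b)\<^sup>2" by simp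
        qed
      qed simp
      have int': "integrable M (\<lambda>x. (norm (s x - f x))\<^sup>2)"
        using int by (simp add: norm_minus_commute)
      have "(\<integral>x. (norm (f (S x) - f x))\<^sup>2 \<partial>M) \<le>
        (\<integral>x. 3 * ((norm (f (S x) - s (S x)))\<^sup>2 + (norm (s (S x) - s x))\<^sup>2 + (norm (s x - f x))\<^sup>2) \<partial>M)"
      proof (rule integral_mono')
        show "integrable M (\<lambda>x. 3 * ((norm (f (S x) - s (S x)))\<^sup>2 + (norm (s (S x) - s x))\<^sup>2 + (norm (s x - f x))\<^sup>2))"
          by (intro integrable_mult_right Bochner_Integration.integrable_add intS ints int')
        show "(norm (f (S x) - f x))\<^sup>2 \<le>
            3 * ((norm (f (S x) - s (S x)))\<^sup>2 + (norm (s (S x) - s x))\<^sup>2 + (norm (s x - f x))\<^sup>2)" for x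
          using norm_add3_squared_le[of "f (S x) - s (S x)" "s (S x) - s x" "s x - f x"] by simp
      qed simp
      also have "\<dots> = 3 * ((\<integral>x. (norm (f x - s x))\<^sup>2 \<partial>M) + (\<integral>x. (norm (s (S x) - s x))\<^sup>2 \<partial>M) +
          (\<integral>x. (norm (f x - s x))\<^sup>2 \<partial>M))"
        using intS ints int' eqS by (simp add: norm_minus_commute[of "s _" "f _"])
      also have "\<dots> < r"
        using small N[OF that] by (simp add: S_def)
      finally show ?thesis by (simp add: S_def)
    qed
    then show "\<exists>N. \<forall>n\<ge>N. norm ((\<integral>x. (norm (f ((T ^^ (2 ^ e n)) x) - f x))\<^sup>2 \<partial>M) - 0) < r"
      by (intro exI[of _ N]) (auto simp: integral_nonneg_AE)
  qed
  from tendsto_real_sqrt[OF this]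
  show "(\<lambda>n. L2_seminorm M (\<lambda>x. f ((T ^^ (2 ^ e n)) x) - f x)) \<longlonglongrightarrow> 0"
    by (simp add: L2_seminorm_def)
qed simp

section \<open>Slow entropy of the scenery partition\<close>

text \<open>It reads the scenery at site 0, so that along an orbit the name samples the scenery at
  the sites \<open>site_shift E k x\<close>.\<close>

definition scenery_partition :: "nat \<Rightarrow> 'a set" where
  "scenery_partition i = {p \<in> space M. snd (\<Phi> p) 0 = (i = 1)}"

lemma measurable_scenery [measurable]: "(\<lambda>p. snd (\<Phi> p) 0) \<in> measurable M (count_space UNIV)"
  by measurable

lemma scenery_partition: "finite_measurable_partition M 2 scenery_partition"
proof -
  have "{1..2::nat} = {1, 2}" by auto
  then show ?thesis
    unfolding finite_measurable_partition_def
    by (auto simp: scenery_partition_def disjoint_family_on_def)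
qed

lemma scenery_name:
  assumes "p \<in> space M"
  shows "name 2 scenery_partition T p k = (if snd (\<Phi> ((T ^^ k) p)) 0 then 1 else 2)"
proof -
  have "{1..2::nat} = {1, 2}" by auto
  then show ?thesis
    unfolding name_def using T_funpow_space[OF assms, of k]
    by (intro the_equality) (auto simp: scenery_partition_def split: if_splits)
qed

lemma sets_hamming_ball:
  "hamming_ball M 2 scenery_partition T N \<epsilon> x \<in> sets M"
proof -
  have "(\<lambda>y. snd (\<Phi> ((T ^^ k) y)) 0) \<in> measurable M (count_space UNIV)" for k
    by (rule measurable_compose[OF measurable_T_funpow measurable_scenery])
  then have "(\<lambda>y. if snd (\<Phi> ((T ^^ k) y)) 0 then 1 else 2 :: nat) \<in> measurable M (count_space UNIV)" for k
    by measurable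
  then have [measurable]: "(\<lambda>y. name 2 scenery_partition T y k) \<in> measurable M (count_space UNIV)" for k
    by (subst measurable_cong[OF scenery_name])
  show ?thesis
    unfolding hamming_ball_def hamming_dist_def by measurable
qed

text \<open>Almost everywhere \<open>\<Phi>\<close> maps the ball into the set of
  \<open>skew_ball_bound\<close>. The word \<open>u\<close> is read directly from the orbit of the
  centre \<open>x\<close>, so \<open>x\<close> itself may lie in the exceptional null set.\<close>

lemma measure_hamming_ball:
  assumes x: "x \<in> space M" and "0 < N" "\<epsilon> \<le> 1 / 8" "N \<le> 2 ^ m"
  shows "measure M (hamming_ball M 2 scenery_partition T N \<epsilon> x) \<le>
    exp (- (real N / (8 * 2 ^ card (E \<inter> {..<m}))))"
proof -
  define u where "u k = snd (\<Phi> ((T ^^ k) x)) 0" for k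
  let ?B = "{y. real (card {k. k < N \<and> u k \<noteq> snd ((skew E ^^ k) y) 0}) < real N / 8}"
  have B: "?B \<in> sets model"
  proof -
    have [measurable]: "(\<lambda>y. snd ((skew E ^^ k) y) 0) \<in> measurable model (count_space UNIV)" for k
      by (rule measurable_compose[OF measurable_skew_funpow]) measurable
    have "{y \<in> space model. real (card {k. k < N \<and> u k \<noteq> snd ((skew E ^^ k) y) 0}) < real N / 8} \<in> sets model"
      by measurable
    then show ?thesis by simp
  qed
  have "AE y in M. y \<in> hamming_ball M 2 scenery_partition T N \<epsilon> x \<longrightarrow> y \<in> \<Phi> -` ?B \<inter> space M"
    using equivariant_funpow AE_space
  proof eventually_elim
    case (elim y)
    show ?case
    proof
      assume "y \<in> hamming_ball M 2 scenery_partition T N \<epsilon> x"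
      moreover have "name 2 scenery_partition T x k \<noteq> name 2 scenery_partition T y k \<longleftrightarrow>
          u k \<noteq> snd ((skew E ^^ k) (\<Phi> y)) 0" for k
        using elim scenery_name[OF x] scenery_name[OF elim(2)] by (auto simp: u_def)
      ultimately have "real (card {k. k < N \<and> u k \<noteq> snd ((skew E ^^ k) (\<Phi> y)) 0}) / real N < \<epsilon>"
        by (simp add: hamming_ball_def hamming_dist_def)
      then have "real (card {k. k < N \<and> u k \<noteq> snd ((skew E ^^ k) (\<Phi> y)) 0}) / real N < 1 / 8"
        using assms(3) by linarith
      then have "real (card {k. k < N \<and> u k \<noteq> snd ((skew E ^^ k) (\<Phi> y)) 0}) < 1 / 8 * real N"
        using \<open>0 < N\<close> by (subst (asm) pos_divide_less_eq) auto
      then show "y \<in> \<Phi> -` ?B \<inter> space M"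
        using elim(2) by simp
    qed
  qed
  then have "measure M (hamming_ball M 2 scenery_partition T N \<epsilon> x) \<le> measure M (\<Phi> -` ?B \<inter> space M)"
    by (rule finite_measure_mono_AE[OF _ sets_vimage_\<Phi>[OF B]])
  also have "\<dots> = measure model ?B" by (rule measure_vimage_\<Phi>[OF B])
  also have "\<dots> \<le> exp (- (real N / (8 * 2 ^ card (E \<inter> {..<m}))))"
    by (rule skew_ball_bound[OF assms(4)])
  finally show ?thesis .
qed

text \<open>Volume counting: balls of exponentially small measure must fill more than
  \<open>1 - \<epsilon> \<ge> 7 / 8\<close> of the space.\<close>

lemma min_ball_cover_lower_bound:
  assumes "0 < N" "0 < \<epsilon>" "\<epsilon> \<le> 1 / 8" "N \<le> 2 ^ m"
  shows "7 / 8 * exp (real N / (8 * 2 ^ card (E \<inter> {..<m}))) \<le>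
    real (min_ball_cover M 2 scenery_partition T N \<epsilon>)"
proof -
  let ?ball = "hamming_ball M 2 scenery_partition T N \<epsilon>"
  let ?nm = "name 2 scenery_partition T"
  let ?P = "\<lambda>k F. F \<subseteq> ?ball ` space M \<and> finite F \<and> card F = k \<and> measure M (\<Union>F) > 1 - \<epsilon>"
  \<comment> \<open>\<open>LEAST\<close> is informative only if a cover exists. A ball depends on
    its centre through the first \<open>N\<close> letters, so there are finitely many balls, and
    together they cover the space.\<close>
  have "finite (?ball ` space M)"
  proof (rule finite_subset)
    let ?R = "PiE {..<N} (\<lambda>_. {1, 2::nat})"
    show "finite ((\<lambda>u. {y \<in> space M. hamming_dist N u (?nm y) < \<epsilon>}) ` ?R)"
      by (intro finite_imageI finite_PiE) auto
    show "?ball ` space M \<subseteq> (\<lambda>u. {y \<in> space M. hamming_dist N u (?nm y) < \<epsilon>}) ` ?R"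
    proof (rule image_subsetI)
      fix x assume x: "x \<in> space M"
      have "hamming_dist N (restrict (?nm x) {..<N}) w = hamming_dist N (?nm x) w" for w
        unfolding hamming_dist_def by (intro arg_cong2[of _ _ _ _ "(/)"] arg_cong[of _ _ "\<lambda>S. real (card S)"]) auto
      then have "?ball x = {y \<in> space M. hamming_dist N (restrict (?nm x) {..<N}) (?nm y) < \<epsilon>}"
        by (simp add: hamming_ball_def)
      then show "?ball x \<in> (\<lambda>u. {y \<in> space M. hamming_dist N u (?nm y) < \<epsilon>}) ` ?R"
        by (intro image_eqI[of _ _ "restrict (?nm x) {..<N}"]) (auto simp: scenery_name[OF x])
    qed
  qed
  moreover have "\<Union>(?ball ` space M) = space M"
    using \<open>0 < \<epsilon>\<close> by (auto simp: hamming_ball_def hamming_dist_def)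
  ultimately have "?P (card (?ball ` space M)) (?ball ` space M)"
    using \<open>0 < \<epsilon>\<close> by (simp add: prob_space)
  then have "\<exists>k F. ?P k F" by blast
  then have "\<exists>F. ?P (min_ball_cover M 2 scenery_partition T N \<epsilon>) F"
    unfolding min_ball_cover_def by (rule LeastI_ex)
  then obtain F where F: "?P (min_ball_cover M 2 scenery_partition T N \<epsilon>) F" by blast
  let ?b = "real N / (8 * 2 ^ card (E \<inter> {..<m}))"
  have "7 / 8 \<le> measure M (\<Union>F)" using F assms(3) by linarith
  also have "\<dots> \<le> (\<Sum>B\<in>F. measure M B)"
    using F sets_hamming_ball by (intro measure_Union_le) auto
  also have "\<dots> \<le> (\<Sum>B\<in>F. exp (- ?b))"
    using F assms by (intro sum_mono) (auto intro!: measure_hamming_ball)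
  also have "\<dots> = real (min_ball_cover M 2 scenery_partition T N \<epsilon>) * exp (- ?b)"
    using F by simp
  finally have "7 / 8 * exp ?b \<le> (real (min_ball_cover M 2 scenery_partition T N \<epsilon>) * exp (- ?b)) * exp ?b"
    by (intro mult_right_mono) auto
  then show ?thesis by (simp add: mult.assoc exp_add[symmetric])
qed

text \<open>For \<open>\<epsilon> \<le> 1 / 8\<close> the growth set of
  \<open>scenery_partition\<close> is all of \<open>{0<..}\<close>, so the rate is infinite before
  any limit or supremum is taken.\<close>

lemma lower_slow_entropy_infinite:
  assumes pos: "\<And>n t. 0 < t \<Longrightarrow> 0 < a n t"
    and growth: "\<And>t. 0 < t \<Longrightarrow> \<forall>\<^sub>F N in sequentially. \<exists>m. N \<le> 2 ^ m \<and>
      a N t \<le> 7 / 8 * exp (real N / (8 * 2 ^ card (E \<inter> {..<m})))"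
  shows "lower_slow_entropy a M T = \<infinity>"
proof -
  have set: "slow_growth_set a M 2 scenery_partition T \<epsilon> = {0<..}" if eps: "0 < \<epsilon>" "\<epsilon> \<le> 1 / 8" for \<epsilon>
  proof -
    have "0 < liminf (\<lambda>n. ereal (real (min_ball_cover M 2 scenery_partition T n \<epsilon>) / a n t))" if t: "0 < t" for t
    proof -
      have "\<forall>\<^sub>F n in sequentially. 1 \<le> ereal (real (min_ball_cover M 2 scenery_partition T n \<epsilon>) / a n t)"
        using growth[OF t] eventually_gt_at_top[of 0]
      proof eventually_elim
        case (elim n)
        then obtain m where "n \<le> 2 ^ m" "a n t \<le> 7 / 8 * exp (real n / (8 * 2 ^ card (E \<inter> {..<m})))" by blast
        then have "a n t \<le> real (min_ball_cover M 2 scenery_partition T n \<epsilon>)"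
          using min_ball_cover_lower_bound[OF elim(2) eps] by (meson order_trans)
        then show ?case using pos[OF t, of n] by (simp add: one_ereal_def)
      qed
      then have "1 \<le> liminf (\<lambda>n. ereal (real (min_ball_cover M 2 scenery_partition T n \<epsilon>) / a n t))"
        by (rule Liminf_bounded)
      then show ?thesis by (rule less_le_trans[rotated]) simp
    qed
    then show ?thesis by (auto simp: slow_growth_set_def)
  qed
  have rate: "slow_growth_rate a M 2 scenery_partition T \<epsilon> = \<infinity>" if "0 < \<epsilon>" "\<epsilon> \<le> 1 / 8" for \<epsilon>
  proof -
    have "(SUP t\<in>{0::real<..}. ereal t) = \<infinity>"
    proof (rule SUP_PInfty)
      show "\<exists>t\<in>{0::real<..}. ereal (real n) \<le> ereal t" for n :: nat
        by (intro bexI[of _ "real n + 1"]) auto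
    qed
    moreover have "{0::real<..} \<noteq> {}" by (auto intro: exI[of _ 1])
    ultimately show ?thesis by (simp add: slow_growth_rate_def set[OF that])
  qed
  have "\<forall>\<^sub>F \<epsilon> in at_right 0. slow_growth_rate a M 2 scenery_partition T \<epsilon> = \<infinity>"
    by (rule eventually_at_rightI[of 0 "1 / 8"]) (auto intro: rate)
  then have "((\<lambda>\<epsilon>. slow_growth_rate a M 2 scenery_partition T \<epsilon>) \<longlongrightarrow> \<infinity>) (at_right 0)"
    by (rule tendsto_eventually)
  then have "Lim (at_right 0) (\<lambda>\<epsilon>. slow_growth_rate a M 2 scenery_partition T \<epsilon>) = \<infinity>"
    by (intro tendsto_Lim) auto
  then have "\<infinity> \<le> lower_slow_entropy a M T"
    unfolding lower_slow_entropy_def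
    by (intro SUP_upper2[of "(2, scenery_partition)"]) (auto simp: scenery_partition)
  then show ?thesis by simp
qed

end

section \<open>Realization on the torus, the disc and the annulus\<close>

locale lebesgue_domain =
  fixes X :: "(real \<times> real) set"
  assumes X_borel [measurable]: "X \<in> sets borel"
    and X_pos: "emeasure lborel X \<noteq> 0"
    and X_finite: "emeasure lborel X \<noteq> \<infinity>"
    and X_bounded: "\<And>p. p \<in> X \<Longrightarrow> \<bar>fst p\<bar> \<le> 1 \<and> \<bar>snd p\<bar> \<le> 1"
begin

text \<open>\<open>\<mu>\<close> is defined on the Borel sets of the plane, where the isomorphism is
  built, and \<open>M\<close> on the Lebesgue measurable subsets of \<open>X\<close>. As a set of
  \<open>M\<close> is Borel up to part of a null set, results pass from \<open>\<mu>\<close> to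
  \<open>M\<close>.\<close>

abbreviation "\<mu> \<equiv> uniform_measure lborel X"
abbreviation "M \<equiv> normalized_lebesgue X"

sublocale U: prob_space \<mu>
  using X_pos X_finite by (intro prob_space_uniform_measure) auto

lemma space_M [simp]: "space M = X"
  by (simp add: normalized_lebesgue_def)

lemma sets_M: "A \<in> sets M \<longleftrightarrow> A \<subseteq> X \<and> A \<in> sets lebesgue"
  by (simp add: normalized_lebesgue_def sets_restrict_space_iff)

lemma emeasure_M: "A \<in> sets M \<Longrightarrow> emeasure M A = emeasure lebesgue A / emeasure lborel X"
proof -
  assume A: "A \<in> sets M"
  then have "A \<subseteq> X" by (simp add: sets_M)
  have "A \<in> sets (lebesgue_on X)" using A by (simp add: normalized_lebesgue_def)
  then have "emeasure M A = emeasure (lebesgue_on X) (X \<inter> A) / emeasure (lebesgue_on X) X"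
    unfolding normalized_lebesgue_def by (intro emeasure_uniform_measure) (auto simp: sets_restrict_space_iff)
  also have "X \<inter> A = A" using \<open>A \<subseteq> X\<close> by auto
  finally show ?thesis using \<open>A \<subseteq> X\<close> by (simp add: emeasure_restrict_space)
qed

lemma null_\<mu>: "N \<in> null_sets \<mu> \<Longrightarrow> X \<inter> N \<in> null_sets lborel"
  using X_finite by (auto simp: null_sets_def ennreal_divide_eq_0_iff)

lemma completion_M:
  assumes "S \<in> sets borel" "S \<subseteq> X" "N \<subseteq> X" "N \<subseteq> N'" "N' \<in> null_sets \<mu>"
  shows "S \<union> N \<in> sets M" "emeasure M (S \<union> N) = emeasure \<mu> S"
proof -
  have n: "X \<inter> N' \<in> null_sets lborel" using assms(5) by (rule null_\<mu>)
  have "N \<subseteq> X \<inter> N'" using assms by auto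
  then have N: "N \<in> null_sets lebesgue" using n by (rule null_sets_completion_subset[rotated, OF null_sets_completionI, rotated])
  have S: "S \<in> sets lebesgue" using assms(1) by auto
  show sets: "S \<union> N \<in> sets M"
    using N S assms by (auto simp: sets_M null_sets_def)
  have "X \<inter> S = S" using assms by auto
  then show "emeasure M (S \<union> N) = emeasure \<mu> S"
    using assms(1) by (simp add: emeasure_M[OF sets] emeasure_Un_null_set[OF S N])
qed

lemma completion_M_cases:
  assumes "A \<in> sets M"
  obtains S N N' where "A = S \<union> N" "S \<in> sets borel" "S \<subseteq> X" "N \<subseteq> X" "N \<subseteq> N'" "N' \<in> null_sets \<mu>"
proof -
  have A: "A \<subseteq> X" "A \<in> sets lebesgue" using assms by (auto simp: sets_M)
  from A(2) obtain S N N' where *: "A = S \<union> N" "N \<subseteq> N'" "N' \<in> null_sets lborel" "S \<in> sets lborel"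
    by (rule sets_completionE)
  have "emeasure lborel (X \<inter> N') \<le> emeasure lborel N'"
    using * by (intro emeasure_mono) auto
  then have "N' \<in> null_sets \<mu>"
    using *(3) by (auto simp: null_sets_def)
  then show thesis using * A(1) by (intro that[of S N N']) auto
qed

lemma emeasure_M_borel: "S \<in> sets borel \<Longrightarrow> emeasure M (S \<inter> X) = emeasure \<mu> S"
  using completion_M(2)[of "S \<inter> X" "{}" "{}"] by (simp add: Int_ac)

lemma sets_M_borel: "S \<in> sets borel \<Longrightarrow> S \<inter> X \<in> sets M"
  by (simp add: sets_M)

lemma AE_M:
  assumes "AE p in \<mu>. P p"
  shows "AE p in M. P p"
proof -
  obtain N where N: "N \<in> null_sets \<mu>" "{p \<in> space \<mu>. \<not> P p} \<subseteq> N"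
    using assms by (auto simp: eventually_ae_filter)
  then have "N \<inter> X \<in> null_sets M"
    using emeasure_M_borel[of N] sets_M_borel[of N] by (auto simp: null_sets_def)
  then show ?thesis by (rule AE_I') (use N in auto)
qed

lemma measurable_M_borel: "f \<in> measurable borel K \<Longrightarrow> f \<in> measurable M K"
proof -
  assume f: "f \<in> measurable borel K"
  show ?thesis
  proof (rule measurableI)
    show "f x \<in> space K" for x using measurable_space[OF f] by simp
    show "f -` A \<inter> space M \<in> sets M" if "A \<in> sets K" for A
      using measurable_sets[OF f that] sets_M_borel[of "f -` A"] by simp
  qed
qed

text \<open>A Borel map can pull Lebesgue null sets back to nonmeasurable sets. Here the null part
  is covered by a null set \<open>N'\<close> of \<open>\<mu>\<close>, whose preimage is null because
  \<open>f\<close> preserves \<open>\<mu>\<close>.\<close>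

lemma preserving_M:
  assumes f: "f \<in> measurable borel borel" and fX: "\<And>p. p \<in> X \<Longrightarrow> f p \<in> X" and d: "distr \<mu> borel f = \<mu>"
  shows "f \<in> measurable M M" "distr M M f = M"
proof -
  have em: "emeasure \<mu> (f -` S) = emeasure \<mu> S" if "S \<in> sets borel" for S
    using emeasure_distr[of f \<mu> borel S] f that by (simp add: d cong: measurable_cong_sets)
  have sb: "f -` S \<in> sets borel" if "S \<in> sets borel" for S
    using measurable_sets[OF f that] by simp
  have *: "f -` A \<inter> X \<in> sets M \<and> emeasure M (f -` A \<inter> X) = emeasure M A" if A: "A \<in> sets M" for A
  proof -
    obtain S N N' where SN: "A = S \<union> N" "S \<in> sets borel" "S \<subseteq> X" "N \<subseteq> X" "N \<subseteq> N'" "N' \<in> null_sets \<mu>"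
      using completion_M_cases[OF A] by blast
    have n: "f -` N' \<in> null_sets \<mu>"
      using SN(6) em[of N'] sb[of N'] by (auto simp: null_sets_def)
    have e: "f -` A \<inter> X = (f -` S \<inter> X) \<union> (f -` N \<inter> X)" using SN(1) by auto
    have "f -` S \<inter> X \<in> sets borel" using sb[OF SN(2)] by auto
    then have c: "(f -` S \<inter> X) \<union> (f -` N \<inter> X) \<in> sets M"
      "emeasure M ((f -` S \<inter> X) \<union> (f -` N \<inter> X)) = emeasure \<mu> (f -` S \<inter> X)"
      using completion_M[of "f -` S \<inter> X" "f -` N \<inter> X" "f -` N'"] n SN(5) by blast+
    have "emeasure \<mu> (f -` S \<inter> X) = emeasure \<mu> (f -` S)"
      using sb[OF SN(2)] by (simp add: Int_commute)
    then have "emeasure M (f -` A \<inter> X) = emeasure M A"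
      by (simp only: e c(2) em[OF SN(2)] completion_M(2)[OF SN(2-6), folded SN(1)])
    then show ?thesis
      using c(1)[folded e] by blast
  qed
  show m: "f \<in> measurable M M"
    by (rule measurableI) (use * fX in auto)
  show "distr M M f = M"
    by (rule measure_eqI) (use * in \<open>auto simp: emeasure_distr[OF m]\<close>)
qed

lemma prob_space_M: "prob_space M"
  using emeasure_M_borel[of X] U.emeasure_space_1 X_borel by (intro prob_spaceI) (simp)

end

lemma distr_skew_inv: "distr model model (skew_inv E) = model"
proof -
  have "distr model model (skew_inv E) = distr (distr model model (skew E)) model (skew_inv E)"
    by (simp add: distr_skew)
  also have "\<dots> = distr model model (\<lambda>y. y)"
    by (subst distr_distr) (auto simp: comp_def)
  finally show ?thesis by (simp add: distr_id)
qed

context lebesgue_domain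
begin

text \<open>The skew product is conjugated to \<open>X\<close> on an invariant set of full measure on which the
  isomorphism modulo null sets is an honest bijection.\<close>

lemma skew_realization:
  "\<exists>T \<Phi>. invertible_measure_preserving M T \<and> skew_extension M T \<Phi> E"
proof -
  obtain f g where f: "f \<in> measurable \<mu> model" and g: "g \<in> measurable model \<mu>"
    and df: "distr \<mu> model f = model" and dg: "distr model \<mu> g = \<mu>"
    and gf: "AE p in \<mu>. g (f p) = p" and fg: "AE y in model. f (g y) = y"
    using isomorphic_uniform_measure_model[OF X_borel X_pos X_finite X_bounded]
    unfolding isomorphic_mod_null_def by blast
  have fb [measurable]: "f \<in> measurable borel model" and gb [measurable]: "g \<in> measurable model borel"
    using f g by (simp_all cong: measurable_cong_sets)
  let ?S = "skew E" and ?S' = "skew_inv E"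
  define Y0 where "Y0 = {y. g y \<in> X \<and> f (g y) = y}"
  have Y0: "Y0 \<in> sets model"
  proof -
    have "f (g y) = y \<longleftrightarrow> (\<forall>i. fst (f (g y)) i = fst y i \<and> snd (f (g y)) i = snd y i)" for y
      by (auto simp: prod_eq_iff fun_eq_iff)
    then have "Y0 = {y \<in> space model. g y \<in> X \<and> (\<forall>i. fst (f (g y)) i = fst y i \<and> snd (f (g y)) i = snd y i)}"
      unfolding Y0_def by simp
    also have "\<dots> \<in> sets model" by measurable
    finally show ?thesis .
  qed
  have "AE p in \<mu>. p \<in> X" by (intro AE_uniform_measureI) auto
  then have "AE y in model. g y \<in> X"
    using AE_distrD[OF g, unfolded dg] by blast
  then have AE_Y0: "AE y in model. y \<in> Y0"
    using fg by eventually_elim (simp add: Y0_def)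
  \<comment> \<open>Points whose whole orbit, in both directions, stays in \<open>Y0\<close>; so
    \<open>Y1\<close> is invariant under the skew product and its inverse.\<close>
  define Y1 where "Y1 = {y. \<forall>n. (?S ^^ n) y \<in> Y0 \<and> (?S' ^^ n) y \<in> Y0}"
  have m: "?S ^^ n \<in> measurable model model" "?S' ^^ n \<in> measurable model model" for n
    by (rule measurable_compose_n, simp)+
  have Y1 [measurable]: "Y1 \<in> sets model"
  proof -
    have "Y1 = (\<Inter>n. ((?S ^^ n) -` Y0 \<inter> space model) \<inter> ((?S' ^^ n) -` Y0 \<inter> space model))"
      by (auto simp: Y1_def)
    also have "\<dots> \<in> sets model"
      using measurable_sets[OF m(1) Y0] measurable_sets[OF m(2) Y0]
      by (intro sets.countable_INT) auto
    finally show ?thesis .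
  qed
  have AE_Y1: "AE y in model. y \<in> Y1"
  proof -
    have "AE y in model. (?S ^^ n) y \<in> Y0" "AE y in model. (?S' ^^ n) y \<in> Y0" for n
      using AE_distrD[OF m(1), unfolded distr_funpow[OF measurable_skew distr_skew], OF AE_Y0]
        AE_distrD[OF m(2), unfolded distr_funpow[OF measurable_skew_inv distr_skew_inv], OF AE_Y0]
      by auto
    then show ?thesis unfolding Y1_def by (simp add: AE_all_countable)
  qed
  have Y1D: "(?S ^^ n) y \<in> Y0" "(?S' ^^ n) y \<in> Y0" if "y \<in> Y1" for y n
    using that by (simp_all add: Y1_def)
  have Y1_Y0: "y \<in> Y0" if "y \<in> Y1" for y
    using Y1D(1)[OF that, of 0] by simp
  have S_Y1: "?S y \<in> Y1" if y: "y \<in> Y1" for y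
  proof -
    have "(?S ^^ n) (?S y) \<in> Y0" for n
      using Y1D(1)[OF y, of "Suc n"] by (simp only: funpow_Suc_right comp_apply)
    moreover have "(?S' ^^ n) (?S y) \<in> Y0" for n
    proof (cases n)
      case 0
      then show ?thesis using Y1D(1)[OF y, of 1] by simp
    next
      case (Suc k)
      then show ?thesis using Y1D(2)[OF y, of k] by (simp only: funpow_Suc_right comp_apply skew_inverse)
    qed
    ultimately show ?thesis by (simp add: Y1_def)
  qed
  have S'_Y1: "?S' y \<in> Y1" if y: "y \<in> Y1" for y
  proof -
    have "(?S' ^^ n) (?S' y) \<in> Y0" for n
      using Y1D(2)[OF y, of "Suc n"] by (simp only: funpow_Suc_right comp_apply)
    moreover have "(?S ^^ n) (?S' y) \<in> Y0" for n
    proof (cases n)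
      case 0
      then show ?thesis using Y1D(2)[OF y, of 1] by simp
    next
      case (Suc k)
      then show ?thesis using Y1D(1)[OF y, of k] by (simp only: funpow_Suc_right comp_apply skew_inverse)
    qed
    ultimately show ?thesis by (simp add: Y1_def)
  qed
  define X1 where "X1 = {p \<in> X. f p \<in> Y1 \<and> g (f p) = p}"
  have X1 [measurable]: "X1 \<in> sets borel"
  proof -
    have "X1 = {p \<in> space borel. p \<in> X \<and> f p \<in> Y1 \<and> g (f p) = p}" by (simp add: X1_def)
    also have "\<dots> \<in> sets borel" by measurable
    finally show ?thesis .
  qed
  have AE_X1: "AE p in \<mu>. p \<in> X1"
    using \<open>AE p in \<mu>. p \<in> X\<close> gf AE_distrD[OF f, unfolded df, OF AE_Y1]
    by eventually_elim (simp add: X1_def)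
  \<comment> \<open>Off \<open>X1\<close>, on a null set, the identity is used: \<open>X1\<close>
    and its complement are each mapped bijectively, so \<open>T\<close> is a bijection of all of
    \<open>X\<close>.\<close>
  define T where "T p = (if p \<in> X1 then g (?S (f p)) else p)" for p
  define T' where "T' p = (if p \<in> X1 then g (?S' (f p)) else p)" for p
  have lift: "g y \<in> X1 \<and> f (g y) = y" if "y \<in> Y1" for y
    using that Y1_Y0[OF that] by (auto simp: X1_def Y0_def)
  have T_X1: "T p \<in> X1" "f (T p) = ?S (f p)" "T' p \<in> X1" "f (T' p) = ?S' (f p)" if "p \<in> X1" for p
    using that lift[OF S_Y1, of "f p"] lift[OF S'_Y1, of "f p"] by (auto simp: T_def T'_def X1_def)
  have T_inverse: "T' (T p) = p" "T (T' p) = p" for p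
  proof -
    have "g (?S' (f (T p))) = p" "g (?S (f (T' p))) = p" if "p \<in> X1"
      using that T_X1[OF that] by (auto simp: X1_def)
    then show "T' (T p) = p" "T (T' p) = p"
      using T_X1[of p] unfolding T'_def[of "T p"] T_def[of "T' p"]
      by (auto simp: T_def T'_def)
  qed
  have T_X: "T p \<in> X" "T' p \<in> X" if "p \<in> X" for p
    using that T_X1[of p] by (cases "p \<in> X1"; auto simp: X1_def T_def T'_def)+
  have mT: "T \<in> measurable borel borel" "T' \<in> measurable borel borel"
    unfolding T_def T'_def by measurable
  have dR: "distr \<mu> borel R = \<mu>" if R: "\<And>p. p \<in> X1 \<Longrightarrow> R p = g (S (f p))" "R \<in> measurable borel borel"
    and S: "S \<in> measurable model model" "distr model model S = model" for R S
  proof -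
    have "distr \<mu> borel R = distr \<mu> borel (\<lambda>p. g (S (f p)))"
      using AE_X1 R S(1) by (intro distr_cong_AE) (auto elim!: eventually_mono cong: measurable_cong_sets)
    also have "\<dots> = distr (distr (distr \<mu> model f) model S) borel g"
      using f gb S by (simp add: distr_distr comp_def)
    also have "\<dots> = distr model borel g" by (simp add: df S)
    also have "\<dots> = distr model \<mu> g" by (rule distr_cong) auto
    finally show ?thesis by (simp add: dg)
  qed
  have dT: "distr \<mu> borel T = \<mu>"
    by (rule dR[of T ?S]) (auto simp: T_def distr_skew mT)
  have dT': "distr \<mu> borel T' = \<mu>"
    by (rule dR[of T' ?S']) (auto simp: T'_def distr_skew_inv mT)
  note TM = preserving_M[OF mT(1) T_X(1) dT] and T'M = preserving_M[OF mT(2) T_X(2) dT']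
  have bij: "bij_betw T X X"
    by (rule bij_betw_byWitness[of _ T']) (use T_inverse T_X in auto)
  have inv: "inv_into X T p = T' p" if "p \<in> X" for p
    using that T_X T_inverse bij by (intro inv_into_f_eq) (auto simp: bij_betw_def)
  have "inv_into X T \<in> measurable M M"
    using T'M(1) by (subst measurable_cong[of _ _ T']) (auto simp: inv)
  then have imp: "invertible_measure_preserving M T"
    unfolding invertible_measure_preserving_def space_M using bij TM by blast
  interpret M: prob_space M by (rule prob_space_M)
  have "skew_extension M T f E"
  proof
    show "T \<in> M \<rightarrow>\<^sub>M M" by (rule TM(1))
    show "distr M M T = M" by (rule TM(2))
    show fM: "f \<in> M \<rightarrow>\<^sub>M model" by (rule measurable_M_borel[OF fb])
    show "distr M model f = model"
    proof (rule measure_eqI)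
      fix B assume "B \<in> sets (distr M model f)"
      then have B: "B \<in> sets model" by simp
      have "f -` B \<in> sets borel" using measurable_sets[OF fb B] by simp
      then show "emeasure (distr M model f) B = emeasure model B"
        using emeasure_distr[OF f B] by (simp add: emeasure_distr[OF fM B] emeasure_M_borel df)
    qed simp
    show "AE p in M. f (T p) = skew E (f p)"
      using AE_M[OF AE_X1] by eventually_elim (rule T_X1)
    fix A assume "A \<in> sets M"
    then obtain S N N' where SN: "A = S \<union> N" "S \<in> sets borel" "S \<subseteq> X" "N \<subseteq> X" "N \<subseteq> N'" "N' \<in> null_sets \<mu>"
      by (rule completion_M_cases)
    have "AE p in M. p \<notin> N'" by (rule AE_M[OF AE_not_in[OF SN(6)]])
    \<comment> \<open>\<open>g\<close> undoes \<open>f\<close> almost everywhere, and the null part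
      \<open>N\<close> of \<open>A\<close> is dropped.\<close>
    then have "AE p in M. p \<in> A \<longleftrightarrow> f p \<in> g -` S"
      using AE_M[OF gf] by eventually_elim (use SN in auto)
    moreover have "g -` S \<in> sets model" using measurable_sets[OF gb SN(2)] by simp
    ultimately show "\<exists>B\<in>sets model. AE p in M. p \<in> A \<longleftrightarrow> f p \<in> B" by blast
  qed
  then show ?thesis using imp by blast
qed

end

lemma lebesgue_domainI:
  assumes "X \<in> {torus, disc, annulus}"
  shows "lebesgue_domain X"
proof
  show "X \<in> sets borel"
    using assms by (auto simp: torus_def disc_def annulus_def intro!: borel_Times)
  have bounded: "\<bar>fst p\<bar> \<le> 1 \<and> \<bar>snd p\<bar> \<le> 1" if "p \<in> X" for p
  proof -
    have "norm p \<le> 1 \<Longrightarrow> \<bar>fst p\<bar> \<le> 1 \<and> \<bar>snd p\<bar> \<le> 1"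
      using norm_fst_le[of "fst p" "snd p"] norm_snd_le[of "snd p" "fst p"] by simp
    then show ?thesis using assms that by (auto simp: torus_def disc_def annulus_def)
  qed
  then show "\<And>p. p \<in> X \<Longrightarrow> \<bar>fst p\<bar> \<le> 1 \<and> \<bar>snd p\<bar> \<le> 1" by blast
  \<comment> \<open>All three domains lie in the square \<open>?C\<close> and contain
    \<open>?B\<close>; its side 1/2 fits into the disc, since the norm is at most the sum of the
    coordinates.\<close>
  let ?C = "cbox (- 1, - 1) (1, 1) :: (real \<times> real) set" and ?B = "box (0, 0) (1 / 2, 1 / 2) :: (real \<times> real) set"
  have "X \<subseteq> ?C"
    using bounded by (force simp: cbox_Pair_eq abs_le_iff)
  then have "emeasure lborel X \<le> emeasure lborel ?C"
    by (intro emeasure_mono) auto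
  also have "\<dots> < \<infinity>" by (rule emeasure_lborel_cbox_finite)
  finally show "emeasure lborel X \<noteq> \<infinity>" by simp
  have "?B \<subseteq> X"
  proof
    fix p :: "real \<times> real" assume "p \<in> ?B"
    then have p: "0 < fst p" "fst p < 1 / 2" "0 < snd p" "snd p < 1 / 2"
      by (auto simp: mem_box Basis_prod_def inner_prod_def)
    have "norm p \<le> norm (fst p) + norm (snd p)" by (cases p) (simp add: norm_Pair sqrt_sum_squares_le_sum_abs)
    then show "p \<in> X"
      using assms p by (cases p) (auto simp: torus_def disc_def annulus_def)
  qed
  then have "emeasure lborel ?B \<le> emeasure lborel X"
    using \<open>X \<in> sets borel\<close> by (intro emeasure_mono) auto
  moreover have "0 < emeasure lborel ?B"
    by (subst emeasure_lborel_box) (auto simp: Basis_prod_def)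
  ultimately show "emeasure lborel X \<noteq> 0" by auto
qed

section \<open>Choice of the blocks\<close>

text \<open>Half of the exponent dominates \<open>b n\<close>; the factor from the other half is
  eventually at least 2 and pays for the constant 7/8.\<close>

lemma eventually_below_exp:
  fixes b :: "nat \<Rightarrow> real"
  assumes pos: "\<And>n. 0 < b n" and lim: "(\<lambda>n. ln (b n) / real n) \<longlonglongrightarrow> 0" and "0 < \<gamma>"
  shows "\<forall>\<^sub>F n in sequentially. b n \<le> 7 / 8 * exp (\<gamma> * real n)"
proof -
  have "\<forall>\<^sub>F n in sequentially. ln (b n) / real n < \<gamma> / 2"
    using assms(3) by (intro order_tendstoD(2)[OF lim]) simp
  moreover have "\<forall>\<^sub>F n in sequentially. 2 / \<gamma> \<le> real n"
    by (rule eventually_ge_at_top[THEN eventually_compose_filterlim[OF _ filterlim_real_sequentially]])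
  ultimately show ?thesis
    using eventually_gt_at_top[of 0]
  proof eventually_elim
    case (elim n)
    then have "ln (b n) < \<gamma> * real n / 2" by (simp add: divide_simps)
    then have "b n \<le> exp (\<gamma> * real n / 2)"
      using pos[of n] by (metis exp_le_cancel_iff exp_ln less_imp_le)
    moreover have "exp (\<gamma> * real n) = exp (\<gamma> * real n / 2) * exp (\<gamma> * real n / 2)"
      by (simp add: exp_add[symmetric])
    moreover have "8 / 7 \<le> exp (\<gamma> * real n / 2)"
    proof -
      have "1 \<le> \<gamma> * real n / 2" using elim assms(3) by (simp add: divide_simps mult.commute)
      then show ?thesis using exp_ge_add_one_self[of "\<gamma> * real n / 2"] by linarith
    qed
    moreover have "exp (\<gamma> * real n / 2) * (8 / 7) \<le> exp (\<gamma> * real n / 2) * exp (\<gamma> * real n / 2)"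
      using calculation(3) by (intro mult_left_mono) auto
    ultimately show ?case by linarith
  qed
qed

text \<open>The number \<open>K n\<close> will be a time beyond which the scaling function is small enough to admit the
  \<open>n\<close>-th block.\<close>

lemma sparse_blocks:
  fixes K :: "nat \<Rightarrow> nat"
  defines "e \<equiv> \<lambda>n. \<Sum>i\<le>n. K i + i + 1"
  defines "E \<equiv> \<Union>n. {e n..<e n + n}"
  shows "strict_mono e" "K n \<le> e n" "infinite (- E)"
    "m \<le> e (Suc n) \<Longrightarrow> card (E \<inter> {..<m}) \<le> (\<Sum>i\<le>n. i)"
proof -
  have step: "e n + n < e (Suc n)" for n by (simp add: e_def)
  show mono: "strict_mono e"
    unfolding strict_mono_Suc_iff using step by (metis le_add1 le_less_trans)
  show "K n \<le> e n" for n
    unfolding e_def using member_le_sum[of n "{..n}" "\<lambda>i. K i + i + 1"] by simp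
  have apart: "e j + j < e n" if "j < n" for j n
    using step[of j] strict_mono_less_eq[OF mono, of "Suc j" n] that by simp
  \<comment> \<open>Consecutive blocks are separated, so the position right after each one is free;
    these positions show that \<open>- E\<close> is infinite.\<close>
  have "e n + n \<notin> E" for n
  proof
    assume "e n + n \<in> E"
    then obtain j where j: "e j \<le> e n + n" "e n + n < e j + j" by (auto simp: E_def)
    show False
      using j apart[of j n] apart[of n j] by (cases j n rule: linorder_cases) auto
  qed
  then have "range (\<lambda>n. e n + n) \<subseteq> - E" by auto
  moreover have "inj (\<lambda>n. e n + n)"
  proof (rule strict_mono_imp_inj_on)
    show "strict_mono (\<lambda>n. e n + n)"
      using mono by (auto simp: strict_mono_def intro: add_strict_mono)
  qed
  then have "infinite (range (\<lambda>n. e n + n))" by (simp add: range_inj_infinite)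
  ultimately show "infinite (- E)" using finite_subset by blast
  show "card (E \<inter> {..<m}) \<le> (\<Sum>i\<le>n. i)" if "m \<le> e (Suc n)" for m n
  proof -
    have "E \<inter> {..<m} \<subseteq> (\<Union>i\<in>{..n}. {e i..<e i + i})"
    proof
      fix x assume x: "x \<in> E \<inter> {..<m}"
      then obtain j where j: "e j \<le> x" "x < e j + j" by (auto simp: E_def)
      then have "e j < e (Suc n)" using x that by auto
      then have "j \<le> n" using strict_mono_less[OF mono, of j "Suc n"] by simp
      then show "x \<in> (\<Union>i\<in>{..n}. {e i..<e i + i})" using j by auto
    qed
    then have "card (E \<inter> {..<m}) \<le> card (\<Union>i\<in>{..n}. {e i..<e i + i})"
      by (intro card_mono) auto
    also have "\<dots> \<le> (\<Sum>i\<le>n. card {e i..<e i + i})" by (rule card_UN_le) simp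
    finally show ?thesis by simp
  qed
qed

text \<open>A diagonal choice: \<open>K n\<close> serves the parameter \<open>n + 1\<close>, and by
  monotonicity in \<open>t\<close> a fixed \<open>t\<close> is served by all but finitely many
  \<open>n\<close>. The exponent allows for the total length of the blocks up to \<open>n\<close>,
  which bounds \<open>card (E \<inter> {..<m})\<close> until the next block starts.\<close>

lemma subexponential_blocks:
  assumes "scaling_function a" and lim: "\<And>t. t > 0 \<Longrightarrow> (\<lambda>n. ln (a n t) / real n) \<longlonglongrightarrow> 0"
  obtains e E where "strict_mono e" "\<And>n. {e n..<e n + n} \<subseteq> E" "infinite (- E)"
    "\<And>t. 0 < t \<Longrightarrow> \<forall>\<^sub>F N in sequentially. \<exists>m. N \<le> 2 ^ m \<and>
      a N t \<le> 7 / 8 * exp (real N / (8 * 2 ^ card (E \<inter> {..<m})))"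
proof -
  have pos: "0 < a n t" if "0 < t" for n t using assms(1) that by (simp add: scaling_function_def)
  have mono_t: "a n s \<le> a n t" if "0 < s" "s \<le> t" for n s t
    using assms(1) that by (cases "s = t") (auto simp: scaling_function_def)
  have "\<forall>n. \<exists>K. \<forall>N\<ge>K. a N (real n + 1) \<le> 7 / 8 * exp (1 / (8 * 2 ^ (\<Sum>i\<le>n. i)) * real N)"
  proof
    fix n
    have "\<forall>\<^sub>F N in sequentially. a N (real n + 1) \<le> 7 / 8 * exp (1 / (8 * 2 ^ (\<Sum>i\<le>n. i)) * real N)"
      by (rule eventually_below_exp) (auto intro!: pos lim)
    then show "\<exists>K. \<forall>N\<ge>K. a N (real n + 1) \<le> 7 / 8 * exp (1 / (8 * 2 ^ (\<Sum>i\<le>n. i)) * real N)"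
      by (simp only: eventually_sequentially)
  qed
  then obtain K where K: "\<And>n N. K n \<le> N \<Longrightarrow>
      a N (real n + 1) \<le> 7 / 8 * exp (1 / (8 * 2 ^ (\<Sum>i\<le>n. i)) * real N)"
    by metis
  define e where "e n = (\<Sum>i\<le>n. K i + i + 1)" for n
  define E where "E = (\<Union>n. {e n..<e n + n})"
  note blocks = sparse_blocks[where K = K, folded e_def E_def]
  show thesis
  proof (rule that)
    show "strict_mono e" "infinite (- E)" by (rule blocks)+
    show "{e n..<e n + n} \<subseteq> E" for n by (auto simp: E_def)
    fix t :: real assume t: "0 < t"
    obtain n0 :: nat where n0: "t \<le> real n0" using real_arch_simple by blast
    show "\<forall>\<^sub>F N in sequentially. \<exists>m. N \<le> 2 ^ m \<and>
      a N t \<le> 7 / 8 * exp (real N / (8 * 2 ^ card (E \<inter> {..<m})))"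
      \<comment> \<open>This start forces \<open>n0 < j\<close> below, so \<open>j\<close> is a
        successor and its predecessor \<open>n\<close> satisfies
        \<open>t \<le> n + 1\<close>.\<close>
      using eventually_gt_at_top[of "2 ^ e n0"]
    proof eventually_elim
      case (elim N)
      \<comment> \<open>Both \<open>m\<close> and \<open>j = Suc n\<close> are least: this gives
        \<open>2 ^ e n < N\<close>, hence \<open>K n \<le> N\<close>, while
        \<open>m \<le> e (Suc n)\<close> keeps all blocks after the \<open>n\<close>-th out of the
        count.\<close>
      define m where "m = (LEAST m. N \<le> 2 ^ m)"
      have m: "N \<le> 2 ^ m" unfolding m_def by (rule LeastI[of _ N]) (simp add: less_imp_le)
      have "(2::nat) ^ e n0 < 2 ^ m" using elim m by (rule less_le_trans)
      then have m0: "e n0 < m" by simp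
      define j where "j = (LEAST j. m \<le> e j)"
      have j: "m \<le> e j"
        unfolding j_def by (rule LeastI[of _ m]) (rule strict_mono_imp_increasing[OF blocks(1)])
      have "e n0 < e j" using m0 j by simp
      then have jn: "n0 < j" using strict_mono_less[OF blocks(1)] by simp
      then obtain n where n: "j = Suc n" by (cases j) auto
      have "\<not> m \<le> e n" using not_less_Least[of n "\<lambda>j. m \<le> e j"] n by (simp add: j_def)
      then have "\<not> N \<le> 2 ^ e n" using not_less_Least[of "e n" "\<lambda>m. N \<le> 2 ^ m"] by (simp add: m_def)
      moreover have "e n < 2 ^ e n" by simp
      ultimately have "K n \<le> N" using blocks(2)[of n] by linarith
      have "a N t \<le> a N (real n + 1)"
        using n0 jn n t by (intro mono_t) auto
      also have "\<dots> \<le> 7 / 8 * exp (1 / (8 * 2 ^ (\<Sum>i\<le>n. i)) * real N)"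
        by (rule K) fact
      also have "\<dots> \<le> 7 / 8 * exp (real N / (8 * 2 ^ card (E \<inter> {..<m})))"
      proof -
        have "(2::real) ^ card (E \<inter> {..<m}) \<le> 2 ^ (\<Sum>i\<le>n. i)"
          using blocks(4)[of m n] j n by (intro power_increasing) auto
        then have "real N / (8 * 2 ^ (\<Sum>i\<le>n. i)) \<le> real N / (8 * 2 ^ card (E \<inter> {..<m}))"
          by (intro divide_left_mono) auto
        then show ?thesis by simp
      qed
      finally show ?case using m by blast
    qed
  qed
qed

theorem theorem4p10:
  fixes a :: "nat \<Rightarrow> real \<Rightarrow> real" and X :: "(real \<times> real) set"
  assumes "scaling_function a"
    and "\<And>t. t > 0 \<Longrightarrow> (\<lambda>n. ln (a n t) / real n) \<longlonglongrightarrow> 0"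
    and "X \<in> {torus, disc, annulus}"
  shows "\<exists>T. invertible_measure_preserving (normalized_lebesgue X) T \<and>
             ergodic (normalized_lebesgue X) T \<and>
             rigid (normalized_lebesgue X) T \<and>
             lower_slow_entropy a (normalized_lebesgue X) T = \<infinity>"
proof -
  interpret lebesgue_domain X by (rule lebesgue_domainI[OF assms(3)])
  obtain e E where e: "strict_mono e" "\<And>n. {e n..<e n + n} \<subseteq> E" "infinite (- E)"
    and growth: "\<And>t. 0 < t \<Longrightarrow> \<forall>\<^sub>F N in sequentially. \<exists>m. N \<le> 2 ^ m \<and>
      a N t \<le> 7 / 8 * exp (real N / (8 * 2 ^ card (E \<inter> {..<m})))"
    using subexponential_blocks[OF assms(1,2)] by blast
  obtain T \<Phi> where T: "invertible_measure_preserving (normalized_lebesgue X) T"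
    and ext: "skew_extension (normalized_lebesgue X) T \<Phi> E"
    using skew_realization by blast
  interpret ext: skew_extension "normalized_lebesgue X" T \<Phi> E by (rule ext)
  have "0 < a n t" if "0 < t" for n t
    using assms(1) that by (simp add: scaling_function_def)
  then have "lower_slow_entropy a (normalized_lebesgue X) T = \<infinity>"
    using growth by (rule ext.lower_slow_entropy_infinite)
  then show ?thesis
    using T ext.ergodic_T[OF e(3)] ext.rigid_T[OF e(1,2)] by blast
qed

end
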